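(* Let $D$ be a finite set, $M=\mathrm{QoI}(D)$, $\sigma:\mathit{Var}\to M_1$, and let $g$ be a mediator family legal for $\sigma$. Then for every command $C$ and every $W\subseteq\mathit{Var}$, $$\pi_W\circ\llbracket C\rrbracket\circ\hat g:\alpha_\sigma(\mathbb J_W)\Rightarrow\mathrm{Id},$$ where $\mathbb J_W=\bigotimes_{w\in W}\Delta_C(w)$ is computed in the set object $\mathcal U(\mathit{Var})$.
   Context: Quantale of information. $D$ is finite. $\mathrm{LoI}(D)$ is the set of equivalence relations on $D$ ordered by $P\sqsubseteq Q$ iff $Q\subseteq P$, so $P\sqcup Q=P\cap Q$, the least element $\mathrm{All}$ is the total relation and the greatest, $\mathrm{Id}$, is equality. For $\mathbb P\subseteq\mathrm{LoI}(D)$, $\mathrm{mix}(\mathbb P)$ is the set of equivalence relations each of whose cells is a cell of some member of $\mathbb P$, and $\mathrm{tc}(\mathbb P)={\downarrow}\mathrm{mix}(\mathbb P)$. $\mathrm{QoI}(D)$ is the set of $\mathbb P$ with $\mathrm{tc}(\mathbb P)=\mathbb P$, ordered by inclusion (written $\sqsubseteq$), with $\bigvee_i\mathbb P_i=\mathrm{tc}(\bigcup_i\mathbb P_i)$, $\mathbb P\otimes\mathbb Q=\mathrm{tc}\{P\sqcup Q\mid P\in\mathbb P,Q\in\mathbb Q\}$, unit $1=\{\mathrm{All}\}$; it is a commutative complete quantale. For a quantale $M$, $M_1=\{m\mid 1\sqsubseteq m\}$, $m^0=1$, $m^n$ is the $n$-fold tensor power, $m^*=\bigvee_{n\ge0}m^n$;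 empty tensors are $1$. Language. $\mathit{Var}$ is finite; stores are maps $\mathit{Var}\to\mathit{Val}$. Commands: $\mathsf{skip}$, $x:=E$, $C_1;C_2$, $\mathsf{if}\;E\;C_1\;C_2$, $\mathsf{while}\;E\;C$, with the standard semantics $\llbracket C\rrbracket$, a partial function on stores (undefined on nontermination). Expressions evaluate totally, their value depends only on the variables in $\mathit{fv}(E)$, and guards are decided by a fixed two-valued test on the value of $E$. $\mathit{asgn}(C)$ is the set of variables assigned in $C$. $\pi_W$ restricts a store to $W$. Mediators. For a partial function $h$ on $D$ and $\mathbb P\in\mathrm{QoI}(D)$, $h:\mathbb P\Rightarrow\mathrm{Id}$ means: some $P\in\mathbb P$ satisfies $h(d)=h(d')$ whenever $d\,P\,d'$ and both are defined. A mediator family is $g=\langle g_v:D\rightharpoonup\mathit{Val}\rangle_{v\in\mathit{Var}}$ of partial functions with a common domain; $\hat g(d)$ is the store with $v$-component $g_v(d)$. $g$ is legal for $\sigma$ when $g_v:\sigma(v)\Rightarrow\mathrm{Id}$ for every $v$. Set object. $\mathcal U=\mathcal U(\mathit{Var})$ is the set of downsets of $(\mathcal P(\mathit{Var}),\subseteq)$ ordered by inclusion, with $\bigvee=\bigcup$, $\mathbb X\otimes\mathbb Y={\downarrow}\{X\cup Y\mid X\in\mathbb X,Y\in\mathbb Y\}$, $1={\downarrow}\emptyset$; generators $\hat v={\downarrow}\{v\}$. $\alpha_\sigma(\mathbb X)=\bigvee_{X\in\mathbb X}\bigotimes_{v\in X}\sigma(v)$. Algorithmic system. For a commutative complete quantale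 $M$, $t_E(\Gamma)=\bigotimes_{v\in\mathit{fv}(E)}\Gamma(v)$ and $\mathcal A^C_M(p,\Gamma):\mathit{Var}\to M_1$ ($p\in M_1$, $\Gamma:\mathit{Var}\to M_1$) is defined by recursion on $C$: $\Gamma$ for $\mathsf{skip}$; $\Gamma[x\mapsto p\otimes t_E(\Gamma)]$ for $x:=E$; $\mathcal A^{C_2}(p,\mathcal A^{C_1}(p,\Gamma))$ for $C_1;C_2$; for $\mathsf{if}\;E\;C_1\;C_2$, with $t=t_E(\Gamma)$, $\Gamma_i'=\mathcal A^{C_i}(p\otimes t,\Gamma)$, the environment $x\mapsto t\otimes(\Gamma_1'(x)\vee\Gamma_2'(x))$ for $x\in\mathit{asgn}(C_1)\cup\mathit{asgn}(C_2)$ and $x\mapsto\Gamma(x)$ otherwise; for $\mathsf{while}\;E\;C$, with $\Gamma^*$ the least fixed point of $\Theta\mapsto\Gamma\vee\mathcal A^C(p\otimes t_E(\Theta),\Theta)$ and $t=t_E(\Gamma^* )$, the environment $x\mapsto t^*\otimes\Gamma^*(x)$ for $x\in\mathit{asgn}(C)$ and $x\mapsto\Gamma^*(x)$ otherwise. $\Delta_C=\mathcal A^C_{\mathcal U}(1,\Delta_0)$ with $\Delta_0(v)=\hat v$. *)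

theory Defs
  imports "HOL-Algebra.FiniteProduct"
begin

section \<open>Commutative complete quantales\<close>

record 'm quantale = "'m monoid" +
  qle :: "'m \<Rightarrow> 'm \<Rightarrow> bool"
  qSup :: "'m set \<Rightarrow> 'm"

locale comm_quantale = comm_monoid M for M :: "('m, 'z) quantale_scheme" (structure) +
  assumes qle_refl: "a \<in> carrier M \<Longrightarrow> qle M a a"
    and qle_antisym: "\<lbrakk>a \<in> carrier M; b \<in> carrier M; qle M a b; qle M b a\<rbrakk> \<Longrightarrow> a = b"
    and qle_trans: "\<lbrakk>a \<in> carrier M; b \<in> carrier M; c \<in> carrier M; qle M a b; qle M b c\<rbrakk>
                    \<Longrightarrow> qle M a c"
    and qSup_closed: "A \<subseteq> carrier M \<Longrightarrow> qSup M A \<in> carrier M"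
    and qSup_upper: "\<lbrakk>A \<subseteq> carrier M; a \<in> A\<rbrakk> \<Longrightarrow> qle M a (qSup M A)"
    and qSup_least: "\<lbrakk>A \<subseteq> carrier M; b \<in> carrier M; \<And>a. a \<in> A \<Longrightarrow> qle M a b\<rbrakk>
                    \<Longrightarrow> qle M (qSup M A) b"
    and mult_qSup: "\<lbrakk>a \<in> carrier M; A \<subseteq> carrier M\<rbrakk>
                    \<Longrightarrow> a \<otimes> qSup M A = qSup M ((\<lambda>b. a \<otimes> b) ` A)"

definition qjoin :: "('m, 'z) quantale_scheme \<Rightarrow> 'm \<Rightarrow> 'm \<Rightarrow> 'm" where
  "qjoin M a b = qSup M {a, b}"

definition qstar :: "('m, 'z) quantale_scheme \<Rightarrow> 'm \<Rightarrow> 'm" where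
  "qstar M a = qSup M (range (\<lambda>n::nat. a [^]\<^bsub>M\<^esub> n))"

text \<open>The part \<open>M\<^sub>1\<close> of \<open>M\<close> above the unit, and the environments with values in it.\<close>

definition above_one :: "('m, 'z) quantale_scheme \<Rightarrow> 'm set" where
  "above_one M = {m \<in> carrier M. qle M \<one>\<^bsub>M\<^esub> m}"

definition envs :: "('m, 'z) quantale_scheme \<Rightarrow> ('v \<Rightarrow> 'm) set" where
  "envs M = {\<Gamma>. \<forall>v. \<Gamma> v \<in> above_one M}"

definition env_le :: "('m, 'z) quantale_scheme \<Rightarrow> ('v \<Rightarrow> 'm) \<Rightarrow> ('v \<Rightarrow> 'm) \<Rightarrow> bool" where
  "env_le M \<Gamma> \<Theta> \<longleftrightarrow> (\<forall>v. qle M (\<Gamma> v) (\<Theta> v))"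

text \<open>Least fixed point among the environments with values in \<open>M\<^sub>1\<close>, ordered pointwise.\<close>

definition env_lfp ::
  "('m, 'z) quantale_scheme \<Rightarrow> (('v \<Rightarrow> 'm) \<Rightarrow> ('v \<Rightarrow> 'm)) \<Rightarrow> ('v \<Rightarrow> 'm)" where
  "env_lfp M F = (THE \<Theta>. \<Theta> \<in> envs M \<and> F \<Theta> = \<Theta> \<and>
                     (\<forall>\<Theta>' \<in> envs M. F \<Theta>' = \<Theta>' \<longrightarrow> env_le M \<Theta> \<Theta>'))"


section \<open>The quantale of information\<close>

text \<open>In the lattice of information \<open>P \<sqsubseteq> Q\<close> means \<open>Q \<subseteq> P\<close>; hence the join of
  \<open>P\<close> and \<open>Q\<close> is \<open>P \<inter> Q\<close>, and \<open>tc\<close> closes under coarser relations.\<close>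

definition LoI :: "'d set \<Rightarrow> 'd rel set" where
  "LoI D = {P. equiv D P}"

definition mix :: "'d set \<Rightarrow> 'd rel set \<Rightarrow> 'd rel set" where
  "mix D PP = {R \<in> LoI D. \<forall>c \<in> D // R. \<exists>P \<in> PP. c \<in> D // P}"

definition tc :: "'d set \<Rightarrow> 'd rel set \<Rightarrow> 'd rel set" where
  "tc D PP = {P \<in> LoI D. \<exists>Q \<in> mix D PP. Q \<subseteq> P}"

definition QoI :: "'d set \<Rightarrow> 'd rel set quantale" where
  "QoI D = \<lparr>carrier = {PP. PP \<subseteq> LoI D \<and> tc D PP = PP},
            mult = (\<lambda>PP QQ. tc D {P \<inter> Q | P Q. P \<in> PP \<and> Q \<in> QQ}),
            one = {D \<times> D},
            qle = (\<subseteq>),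
            qSup = (\<lambda>F. tc D (\<Union>F))\<rparr>"


section \<open>The set object\<close>

definition down :: "'v set set \<Rightarrow> 'v set set" where
  "down XX = {Y. \<exists>X \<in> XX. Y \<subseteq> X}"

definition SetObj :: "'v set set quantale" where
  "SetObj = \<lparr>carrier = {XX. down XX = XX},
             mult = (\<lambda>XX YY. down {X \<union> Y | X Y. X \<in> XX \<and> Y \<in> YY}),
             one = down {{}},
             qle = (\<subseteq>),
             qSup = Union\<rparr>"

definition gen :: "'v \<Rightarrow> 'v set set" where
  "gen v = down {{v}}"

definition alpha :: "('m, 'z) quantale_scheme \<Rightarrow> ('v \<Rightarrow> 'm) \<Rightarrow> 'v set set \<Rightarrow> 'm" where
  "alpha M \<sigma> XX = qSup M ((\<lambda>X. \<Otimes>\<^bsub>M\<^esub>v\<in>X. \<sigma> v) ` XX)"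


section \<open>The two instances are commutative complete quantales\<close>

lemma LoI_D: "P \<in> LoI D \<Longrightarrow> P \<subseteq> D \<times> D"
  and LoI_refl: "P \<in> LoI D \<Longrightarrow> a \<in> D \<Longrightarrow> (a, a) \<in> P"
  and LoI_sym: "P \<in> LoI D \<Longrightarrow> (a, b) \<in> P \<Longrightarrow> (b, a) \<in> P"
  and LoI_trans: "P \<in> LoI D \<Longrightarrow> (a, b) \<in> P \<Longrightarrow> (b, c) \<in> P \<Longrightarrow> (a, c) \<in> P"
  unfolding LoI_def equiv_def refl_on_def sym_def trans_def by blast+

lemma LoI_I:
  assumes "P \<subseteq> D \<times> D" "\<And>a. a \<in> D \<Longrightarrow> (a, a) \<in> P" "\<And>a b. (a, b) \<in> P \<Longrightarrow> (b, a) \<in> P"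
    "\<And>a b c. (a, b) \<in> P \<Longrightarrow> (b, c) \<in> P \<Longrightarrow> (a, c) \<in> P"
  shows "P \<in> LoI D"
  using assms unfolding LoI_def equiv_def refl_on_def sym_def trans_def by blast

lemma LoI_Int: "P \<in> LoI D \<Longrightarrow> Q \<in> LoI D \<Longrightarrow> P \<inter> Q \<in> LoI D"
proof (rule LoI_I)
  assume P: "P \<in> LoI D" and Q: "Q \<in> LoI D"
  show "P \<inter> Q \<subseteq> D \<times> D" using LoI_D[OF P] by blast
  show "(a, a) \<in> P \<inter> Q" if "a \<in> D" for a
    using LoI_refl[OF P that] LoI_refl[OF Q that] by blast
  show "(b, a) \<in> P \<inter> Q" if "(a, b) \<in> P \<inter> Q" for a b
    using LoI_sym[OF P] LoI_sym[OF Q] that by blast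
  show "(a, c) \<in> P \<inter> Q" if "(a, b) \<in> P \<inter> Q" "(b, c) \<in> P \<inter> Q" for a b c
    using LoI_trans[OF P] LoI_trans[OF Q] that by blast
qed

lemma LoI_total: "D \<times> D \<in> LoI D"
  by (rule LoI_I) auto

lemma LoI_cell: "P \<in> LoI D \<Longrightarrow> (a, b) \<in> P \<Longrightarrow> P `` {a} = P `` {b}"
  by (rule equiv_class_eq) (auto simp: LoI_def)

lemma mem_mix:
  assumes "PP \<subseteq> LoI D"
  shows "R \<in> mix D PP \<longleftrightarrow> R \<in> LoI D \<and> (\<forall>a\<in>D. \<exists>P\<in>PP. R `` {a} = P `` {a})"
proof -
  have cell: "R `` {a} \<in> D // P \<longleftrightarrow> R `` {a} = P `` {a}" if "R \<in> LoI D" "P \<in> PP" "a \<in> D" for P a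
  proof
    assume "R `` {a} \<in> D // P"
    then obtain b where b: "R `` {a} = P `` {b}" by (rule quotientE)
    have "a \<in> R `` {a}" using LoI_refl[OF that(1,3)] by (rule ImageI) simp
    then have "(b, a) \<in> P" unfolding b by simp
    moreover have "P \<in> LoI D" using that(2) assms by blast
    ultimately have "P `` {b} = P `` {a}" by (intro LoI_cell)
    then show "R `` {a} = P `` {a}" using b by simp
  next
    assume *: "R `` {a} = P `` {a}"
    show "R `` {a} \<in> D // P" unfolding * using that(3) by (rule quotientI)
  qed
  have "R \<in> mix D PP \<longleftrightarrow> R \<in> LoI D \<and> (\<forall>c \<in> D // R. \<exists>P\<in>PP. c \<in> D // P)"
    by (simp only: mix_def mem_Collect_eq)
  also have "(\<forall>c \<in> D // R. \<exists>P\<in>PP. c \<in> D // P) \<longleftrightarrow> (\<forall>a\<in>D. \<exists>P\<in>PP. R `` {a} \<in> D // P)"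
    (is "(\<forall>c \<in> D // R. ?Q c) \<longleftrightarrow> _")
  proof
    assume "\<forall>c \<in> D // R. ?Q c"
    then show "\<forall>a\<in>D. ?Q (R `` {a})" by (intro ballI) (erule bspec, rule quotientI)
  next
    assume *: "\<forall>a\<in>D. ?Q (R `` {a})"
    show "\<forall>c \<in> D // R. ?Q c"
    proof
      fix c assume "c \<in> D // R"
      then obtain a where "c = R `` {a}" "a \<in> D" by (rule quotientE)
      then show "?Q c" using * by simp
    qed
  qed
  also have "(R \<in> LoI D \<and> \<dots>) \<longleftrightarrow> (R \<in> LoI D \<and> (\<forall>a\<in>D. \<exists>P\<in>PP. R `` {a} = P `` {a}))"
    by (intro conj_cong refl ball_cong bex_cong cell)
  finally show ?thesis .
qed

lemma tc_LoI: "tc D PP \<subseteq> LoI D"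
  by (auto simp: tc_def)

lemma tc_mono: "PP \<subseteq> QQ \<Longrightarrow> tc D PP \<subseteq> tc D QQ"
proof -
  assume "PP \<subseteq> QQ"
  then have "mix D PP \<subseteq> mix D QQ" unfolding mix_def by (intro Collect_mono) (meson subsetD)
  then show ?thesis unfolding tc_def by (intro Collect_mono) (meson subsetD)
qed

lemma tc_extensive:
  assumes "PP \<subseteq> LoI D" shows "PP \<subseteq> tc D PP"
proof
  fix P assume P: "P \<in> PP"
  then have L: "P \<in> LoI D" using assms by (rule subsetD[rotated])
  have "P \<in> mix D PP" unfolding mem_mix[OF assms] using L by (intro conjI ballI bexI[OF _ P] refl)
  then show "P \<in> tc D PP" unfolding tc_def using L by (intro CollectI conjI bexI[of _ P] order_refl)
qed

lemma tc_idem: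
  assumes "PP \<subseteq> LoI D" shows "tc D (tc D PP) = tc D PP"
proof
  show "tc D PP \<subseteq> tc D (tc D PP)" by (intro tc_extensive tc_LoI)
  show "tc D (tc D PP) \<subseteq> tc D PP"
  proof
    fix R assume "R \<in> tc D (tc D PP)"
    then obtain Q where R: "R \<in> LoI D" "Q \<subseteq> R" and Q: "Q \<in> mix D (tc D PP)"
      by (auto simp: tc_def)
    have QL: "Q \<in> LoI D" using Q by (auto simp: mix_def)
    have ex: "\<exists>S \<in> mix D PP. \<forall>x \<in> Q `` {a}. S `` {x} \<subseteq> Q `` {a}" if a: "a \<in> D" for a
    proof -
      obtain T where T: "T \<in> tc D PP" "Q `` {a} = T `` {a}"
        using Q a unfolding mem_mix[OF tc_LoI] by meson
      then obtain S where "S \<in> mix D PP" "S \<subseteq> T" by (auto simp: tc_def)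
      have TL: "T \<in> LoI D" using T(1) tc_LoI by (rule subsetD[rotated])
      have "S `` {x} \<subseteq> T `` {a}" if "x \<in> T `` {a}" for x
        using LoI_trans[OF TL, of a x] that \<open>S \<subseteq> T\<close> by blast
      with \<open>S \<in> mix D PP\<close> show ?thesis unfolding T(2) by blast
    qed
    define s where "s c = (SOME S. S \<in> mix D PP \<and> (\<forall>x \<in> c. S `` {x} \<subseteq> c))" for c
    have s: "s (Q `` {a}) \<in> mix D PP" "x \<in> Q `` {a} \<Longrightarrow> s (Q `` {a}) `` {x} \<subseteq> Q `` {a}"
      if "a \<in> D" for a x
    proof -
      have "\<exists>S. S \<in> mix D PP \<and> (\<forall>x \<in> Q `` {a}. S `` {x} \<subseteq> Q `` {a})"
        using ex[OF that] by blast
      from someI_ex[OF this, folded s_def]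
      show "s (Q `` {a}) \<in> mix D PP" "x \<in> Q `` {a} \<Longrightarrow> s (Q `` {a}) `` {x} \<subseteq> Q `` {a}"
        by simp_all
    qed
    have sL: "s (Q `` {a}) \<in> LoI D" if "a \<in> D" for a
      using s(1)[OF that] by (auto simp: mix_def)
    define Q' where "Q' = {(x, y) \<in> Q. (x, y) \<in> s (Q `` {x})}"
    have cell: "Q' `` {a} = s (Q `` {a}) `` {a}" if "a \<in> D" for a
      using s(2)[OF that, of a] LoI_refl[OF QL that] unfolding Q'_def by auto
    have "Q' \<in> LoI D"
    proof (rule LoI_I)
      show "Q' \<subseteq> D \<times> D" using LoI_D[OF QL] by (auto simp: Q'_def)
      show "(a, a) \<in> Q'" if "a \<in> D" for a
        using LoI_refl[OF sL[OF that] that] LoI_refl[OF QL that] unfolding Q'_def by blast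
      show "(b, a) \<in> Q'" if "(a, b) \<in> Q'" for a b
      proof -
        have *: "(a, b) \<in> Q" "(a, b) \<in> s (Q `` {a})" using that by (auto simp: Q'_def)
        have "a \<in> D" using * LoI_D[OF QL] by auto
        then show ?thesis
          using LoI_cell[OF QL *(1)] LoI_sym[OF QL *(1)] LoI_sym[OF sL *(2)]
          unfolding Q'_def by simp
      qed
      show "(a, c) \<in> Q'" if "(a, b) \<in> Q'" "(b, c) \<in> Q'" for a b c
      proof -
        have *: "(a, b) \<in> Q" "(a, b) \<in> s (Q `` {a})" "(b, c) \<in> Q" "(b, c) \<in> s (Q `` {b})"
          using that by (auto simp: Q'_def)
        have a: "a \<in> D" using * LoI_D[OF QL] by auto
        show ?thesis
          using *(4) LoI_cell[OF QL *(1)] LoI_trans[OF QL *(1,3)] LoI_trans[OF sL[OF a] *(2)]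
          unfolding Q'_def by simp
      qed
    qed
    moreover have "\<exists>P \<in> PP. Q' `` {a} = P `` {a}" if "a \<in> D" for a
      using s(1)[OF that] that unfolding cell[OF that] mem_mix[OF assms] by blast
    ultimately have "Q' \<in> mix D PP" by (simp add: mem_mix[OF assms])
    then show "R \<in> tc D PP" using R(1)
      unfolding tc_def by (intro CollectI conjI bexI[of _ Q']) (use R(2) in \<open>auto simp: Q'_def\<close>)
  qed
qed

lemma tc_least: "PP \<subseteq> LoI D \<Longrightarrow> QQ \<subseteq> tc D PP \<Longrightarrow> tc D QQ \<subseteq> tc D PP"
  using tc_mono[of QQ "tc D PP" D] tc_idem[of PP D] by simp

definition meets :: "'d rel set \<Rightarrow> 'd rel set \<Rightarrow> 'd rel set" where
  "meets PP QQ = {P \<inter> Q | P Q. P \<in> PP \<and> Q \<in> QQ}"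

lemma meets_LoI: "PP \<subseteq> LoI D \<Longrightarrow> QQ \<subseteq> LoI D \<Longrightarrow> meets PP QQ \<subseteq> LoI D"
  unfolding meets_def using LoI_Int by blast

lemma meets_commute: "meets PP QQ = meets QQ PP"
  unfolding meets_def by blast

lemma meets_assoc: "meets (meets PP QQ) RR = meets PP (meets QQ RR)"
proof -
  have "meets (meets PP QQ) RR = {(P \<inter> Q) \<inter> R | P Q R. P \<in> PP \<and> Q \<in> QQ \<and> R \<in> RR}"
    unfolding meets_def by blast
  also have "\<dots> = {P \<inter> (Q \<inter> R) | P Q R. P \<in> PP \<and> Q \<in> QQ \<and> R \<in> RR}"
    by (simp only: Int_assoc)
  also have "\<dots> = meets PP (meets QQ RR)"
    unfolding meets_def by blast
  finally show ?thesis .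
qed

lemma meets_mono: "PP \<subseteq> PP' \<Longrightarrow> meets PP QQ \<subseteq> meets PP' QQ"
  unfolding meets_def by blast

lemma tc_meets:
  assumes "PP \<subseteq> LoI D" "QQ \<subseteq> LoI D"
  shows "tc D (meets (tc D PP) QQ) = tc D (meets PP QQ)"
proof
  show "tc D (meets PP QQ) \<subseteq> tc D (meets (tc D PP) QQ)"
    by (intro tc_mono meets_mono tc_extensive assms)
  have L: "meets PP QQ \<subseteq> LoI D" using assms by (rule meets_LoI)
  show "tc D (meets (tc D PP) QQ) \<subseteq> tc D (meets PP QQ)"
  proof (rule tc_least[OF L], rule subsetI)
    fix R assume "R \<in> meets (tc D PP) QQ"
    then obtain P P' Q where *: "R = P' \<inter> Q" "P' \<in> LoI D" "P \<in> mix D PP" "P \<subseteq> P'" "Q \<in> QQ"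
      by (auto simp: meets_def tc_def)
    have PL: "P \<in> LoI D" and QL: "Q \<in> LoI D" using * assms by (auto simp: mix_def)
    have "\<exists>S \<in> meets PP QQ. (P \<inter> Q) `` {a} = S `` {a}" if a: "a \<in> D" for a
    proof -
      obtain P0 where P0: "P0 \<in> PP" "P `` {a} = P0 `` {a}"
        using *(3) a unfolding mem_mix[OF assms(1)] by meson
      have "(P \<inter> Q) `` {a} = (P0 \<inter> Q) `` {a}" using P0(2) by (simp add: set_eq_iff)
      moreover have "P0 \<inter> Q \<in> meets PP QQ" using P0 *(5) by (auto simp: meets_def)
      ultimately show ?thesis by blast
    qed
    then have "P \<inter> Q \<in> mix D (meets PP QQ)"
      unfolding mem_mix[OF L] using LoI_Int[OF PL QL] by (intro conjI ballI)
    moreover have "R \<in> LoI D" using *(1,2) QL by (simp add: LoI_Int)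
    moreover have "P \<inter> Q \<subseteq> R" using *(1,4) by blast
    ultimately show "R \<in> tc D (meets PP QQ)" unfolding tc_def by (intro CollectI conjI bexI)
  qed
qed

lemma QoI_simps:
  "carrier (QoI D) = {PP. PP \<subseteq> LoI D \<and> tc D PP = PP}"
  "PP \<otimes>\<^bsub>QoI D\<^esub> QQ = tc D (meets PP QQ)"
  "\<one>\<^bsub>QoI D\<^esub> = {D \<times> D}"
  "qle (QoI D) = (\<subseteq>)"
  "qSup (QoI D) F = tc D (\<Union>F)"
  by (auto simp: QoI_def meets_def)

lemma tc_unit: "tc D {D \<times> D} = {D \<times> D}"
proof (intro equalityI subsetI)
  have L: "{D \<times> D} \<subseteq> LoI D" using LoI_total by blast
  fix R assume "R \<in> tc D {D \<times> D}"
  then obtain Q where R: "R \<in> LoI D" "Q \<subseteq> R" "Q \<in> mix D {D \<times> D}" by (auto simp: tc_def)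
  then have "\<forall>a\<in>D. Q `` {a} = (D \<times> D) `` {a}" unfolding mem_mix[OF L] by simp
  then have "D \<times> D \<subseteq> Q" by blast
  then show "R \<in> {D \<times> D}" using R LoI_D by blast
next
  fix R assume "R \<in> {D \<times> D}"
  then show "R \<in> tc D {D \<times> D}" using tc_extensive[of "{D \<times> D}" D] LoI_total by blast
qed

lemma comm_quantale_QoI: "comm_quantale (QoI D)"
proof (intro comm_quantale.intro comm_monoidI comm_quantale_axioms.intro, unfold QoI_simps)
  let ?C = "{PP. PP \<subseteq> LoI D \<and> tc D PP = PP}"
  note L = meets_LoI tc_LoI tc_idem
  show "tc D (meets PP QQ) \<in> ?C" if "PP \<in> ?C" "QQ \<in> ?C" for PP QQ
    using that by (simp add: L)
  show "{D \<times> D} \<in> ?C" by (simp add: tc_unit LoI_total)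
  show "tc D (meets (tc D (meets PP QQ)) RR) = tc D (meets PP (tc D (meets QQ RR)))"
    if "PP \<in> ?C" "QQ \<in> ?C" "RR \<in> ?C" for PP QQ RR
  proof -
    have "tc D (meets (tc D (meets PP QQ)) RR) = tc D (meets (meets PP QQ) RR)"
      using that by (intro tc_meets meets_LoI) auto
    also have "\<dots> = tc D (meets (meets QQ RR) PP)"
      by (metis meets_assoc meets_commute)
    also have "\<dots> = tc D (meets (tc D (meets QQ RR)) PP)"
      using that by (intro tc_meets[symmetric] meets_LoI) auto
    finally show ?thesis by (simp only: meets_commute[of PP])
  qed
  show "tc D (meets {D \<times> D} PP) = PP" if "PP \<in> ?C" for PP
  proof -
    have "(D \<times> D) \<inter> P = P" if "P \<in> PP" for P
      using that \<open>PP \<in> ?C\<close> LoI_D by blast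
    then have "meets {D \<times> D} PP = PP" unfolding meets_def by auto
    then show ?thesis using that by simp
  qed
  show "tc D (meets PP QQ) = tc D (meets QQ PP)" for PP QQ by (simp add: meets_commute)
  show "tc D (\<Union>F) \<in> ?C" if "F \<subseteq> ?C" for F
  proof -
    have "\<Union>F \<subseteq> LoI D" using that by blast
    then show ?thesis by (simp add: tc_LoI tc_idem)
  qed
  show "PP \<subseteq> tc D (\<Union>F)" if "F \<subseteq> ?C" "PP \<in> F" for F PP
    using that tc_extensive[of "\<Union>F" D] by blast
  show "tc D (\<Union>F) \<subseteq> QQ" if "F \<subseteq> ?C" "QQ \<in> ?C" "\<And>PP. PP \<in> F \<Longrightarrow> PP \<subseteq> QQ" for F QQ
    proof -
    have "\<Union>F \<subseteq> QQ" using that(3) by blast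
    then show ?thesis using that(2) tc_mono[of "\<Union>F" QQ D] by simp
  qed
  show "tc D (meets PP (tc D (\<Union>F))) = tc D (\<Union> ((\<lambda>QQ. tc D (meets PP QQ)) ` F))"
    if "PP \<in> ?C" "F \<subseteq> ?C" for PP F
  proof -
    have FL: "\<Union>F \<subseteq> LoI D" and PL: "PP \<subseteq> LoI D" using that by blast+
    have "tc D (meets PP (tc D (\<Union>F))) = tc D (meets PP (\<Union>F))"
      using tc_meets[OF FL PL] by (simp add: meets_commute)
    also have "meets PP (\<Union>F) = \<Union> (meets PP ` F)" unfolding meets_def by blast
    also have "tc D \<dots> = tc D (\<Union> ((\<lambda>QQ. tc D (meets PP QQ)) ` F))"
    proof
      have m: "meets PP QQ \<subseteq> LoI D" if "QQ \<in> F" for QQ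
        using that FL PL by (intro meets_LoI) auto
      then show "tc D (\<Union> (meets PP ` F)) \<subseteq> tc D (\<Union> ((\<lambda>QQ. tc D (meets PP QQ)) ` F))"
        by (intro tc_mono UN_mono tc_extensive) auto
      have "tc D (meets PP QQ) \<subseteq> tc D (\<Union> (meets PP ` F))" if "QQ \<in> F" for QQ
        by (rule tc_mono) (use that in blast)
      then show "tc D (\<Union> ((\<lambda>QQ. tc D (meets PP QQ)) ` F)) \<subseteq> tc D (\<Union> (meets PP ` F))"
        using m by (intro tc_least) auto
    qed
    finally show ?thesis .
  qed
qed auto

lemma mem_down: "Y \<in> down XX \<longleftrightarrow> (\<exists>X \<in> XX. Y \<subseteq> X)"
  by (simp add: down_def)

definition unions :: "'v set set \<Rightarrow> 'v set set \<Rightarrow> 'v set set" where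
  "unions XX YY = {X \<union> Y | X Y. X \<in> XX \<and> Y \<in> YY}"

lemma SetObj_simps:
  "carrier SetObj = {XX. down XX = XX}"
  "XX \<otimes>\<^bsub>SetObj\<^esub> YY = down (unions XX YY)"
  "\<one>\<^bsub>SetObj\<^esub> = down {{}}"
  "qle SetObj = (\<subseteq>)"
  "qSup SetObj F = \<Union>F"
  by (auto simp: SetObj_def unions_def)

lemma down_extensive: "XX \<subseteq> down XX"
  by (rule subsetI, subst mem_down) (rule bexI, rule order_refl)

lemma down_idem: "down (down XX) = down XX"
proof (rule subset_antisym[OF subsetI down_extensive])
  fix Y assume "Y \<in> down (down XX)"
  then obtain X X' where "X' \<in> XX" "X \<subseteq> X'" "Y \<subseteq> X" by (auto simp: mem_down)
  then show "Y \<in> down XX" unfolding mem_down by (meson order_trans)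
qed

lemma unionsI: "X \<in> XX \<Longrightarrow> Y \<in> YY \<Longrightarrow> X \<union> Y \<in> unions XX YY"
  unfolding unions_def by blast

lemma unionsE:
  assumes "Z \<in> unions XX YY"
  obtains X Y where "X \<in> XX" "Y \<in> YY" "Z = X \<union> Y"
  using assms unfolding unions_def by (elim CollectE exE conjE)

lemma unions_commute: "unions XX YY = unions YY XX"
  unfolding unions_def by blast

lemma unions_assoc: "unions (unions XX YY) ZZ = unions XX (unions YY ZZ)"
proof -
  have "unions (unions XX YY) ZZ = {(X \<union> Y) \<union> Z | X Y Z. X \<in> XX \<and> Y \<in> YY \<and> Z \<in> ZZ}"
    unfolding unions_def by blast
  also have "\<dots> = {X \<union> (Y \<union> Z) | X Y Z. X \<in> XX \<and> Y \<in> YY \<and> Z \<in> ZZ}"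
    by (simp only: Un_assoc)
  also have "\<dots> = unions XX (unions YY ZZ)"
    unfolding unions_def by blast
  finally show ?thesis .
qed

lemma mem_down_unions: "Z \<in> down (unions XX YY) \<longleftrightarrow> (\<exists>X \<in> XX. \<exists>Y \<in> YY. Z \<subseteq> X \<union> Y)"
proof
  assume "Z \<in> down (unions XX YY)"
  then obtain U where U: "U \<in> unions XX YY" "Z \<subseteq> U" unfolding mem_down by (elim bexE)
  from U(1) show "\<exists>X \<in> XX. \<exists>Y \<in> YY. Z \<subseteq> X \<union> Y"
  proof (rule unionsE)
    fix X Y assume *: "X \<in> XX" "Y \<in> YY" "U = X \<union> Y"
    show ?thesis using U(2) unfolding *(3) by (rule bexI[OF bexI[OF _ *(2)] *(1)])
  qed
next
  assume "\<exists>X \<in> XX. \<exists>Y \<in> YY. Z \<subseteq> X \<union> Y"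
  then obtain X Y where "X \<in> XX" "Y \<in> YY" and Z: "Z \<subseteq> X \<union> Y" by (elim bexE)
  then have "X \<union> Y \<in> unions XX YY" by (intro unionsI)
  with Z show "Z \<in> down (unions XX YY)" unfolding mem_down by (rule bexI)
qed

lemma down_unions: "down (unions (down XX) YY) = down (unions XX YY)"
proof (intro Set.set_eqI iffI)
  fix Z assume "Z \<in> down (unions (down XX) YY)"
  then obtain X Y where X: "X \<in> down XX" and Y: "Y \<in> YY" and Z: "Z \<subseteq> X \<union> Y"
    unfolding mem_down_unions by (elim bexE)
  from X obtain X' where X': "X' \<in> XX" "X \<subseteq> X'" unfolding mem_down by (elim bexE)
  have "X \<union> Y \<subseteq> X' \<union> Y" using X'(2) by (rule Un_mono) (rule order_refl)
  with Z have "Z \<subseteq> X' \<union> Y" by (rule order_trans)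
  then show "Z \<in> down (unions XX YY)"
    unfolding mem_down_unions by (rule bexI[OF bexI[OF _ Y] X'(1)])
next
  fix Z assume "Z \<in> down (unions XX YY)"
  then obtain X Y where X: "X \<in> XX" and Y: "Y \<in> YY" and Z: "Z \<subseteq> X \<union> Y"
    unfolding mem_down_unions by (elim bexE)
  from X have "X \<in> down XX" by (rule subsetD[OF down_extensive])
  from Z show "Z \<in> down (unions (down XX) YY)"
    unfolding mem_down_unions by (rule bexI[OF bexI[OF _ Y] \<open>X \<in> down XX\<close>])
qed

lemma comm_quantale_SetObj: "comm_quantale (SetObj :: 'v set set quantale)"
proof (intro comm_quantale.intro comm_monoidI comm_quantale_axioms.intro, unfold SetObj_simps)
  let ?C = "{XX :: 'v set set. down XX = XX}"
  show "down (unions XX YY) \<in> ?C" for XX YY :: "'v set set" by (simp add: down_idem)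
  show "down {{}} \<in> ?C" by (simp add: down_idem)
  show "down (unions (down (unions XX YY)) ZZ) = down (unions XX (down (unions YY ZZ)))"
    for XX YY ZZ :: "'v set set"
    by (metis down_unions unions_assoc unions_commute)
  show "down (unions (down {{}}) XX) = XX" if "XX \<in> ?C" for XX
  proof -
    have "unions {{}} XX = XX" by (auto simp: unions_def)
    then show ?thesis using that by (simp add: down_unions)
  qed
  show "down (unions XX YY) = down (unions YY XX)" for XX YY :: "'v set set"
    by (simp add: unions_commute)
  show "\<Union>F \<in> ?C" if "F \<subseteq> ?C" for F
  proof -
    have "Y \<in> \<Union>F" if Y: "Y \<in> down (\<Union>F)" for Y
    proof -
      obtain XX X where X: "XX \<in> F" "X \<in> XX" "Y \<subseteq> X" using Y by (auto simp: mem_down)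
      then have "Y \<in> down XX" unfolding mem_down by (intro bexI)
      also have "down XX = XX" using \<open>F \<subseteq> ?C\<close> X(1) by blast
      finally show ?thesis using X(1) by (intro UnionI)
    qed
    then have "down (\<Union>F) \<subseteq> \<Union>F" by (rule subsetI)
    then show ?thesis using down_extensive by (intro CollectI subset_antisym)
  qed
  show "\<Union>F \<subseteq> YY" if "\<And>XX. XX \<in> F \<Longrightarrow> XX \<subseteq> YY" for F and YY :: "'v set set"
    using that by (rule Union_least)
  show "down (unions XX (\<Union>F)) = \<Union> ((\<lambda>YY. down (unions XX YY)) ` F)" for XX :: "'v set set" and F
  proof (rule Set.set_eqI)
    fix Z
    have "Z \<in> down (unions XX (\<Union>F)) \<longleftrightarrow> (\<exists>YY \<in> F. \<exists>X \<in> XX. \<exists>Y \<in> YY. Z \<subseteq> X \<union> Y)"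
    proof -
      have "Z \<in> down (unions XX (\<Union>F)) \<longleftrightarrow> (\<exists>X \<in> XX. \<exists>YY \<in> F. \<exists>Y \<in> YY. Z \<subseteq> X \<union> Y)"
        by (simp only: mem_down_unions Union_iff Bex_def) (meson UnionE UnionI)
      also have "\<dots> \<longleftrightarrow> (\<exists>YY \<in> F. \<exists>X \<in> XX. \<exists>Y \<in> YY. Z \<subseteq> X \<union> Y)"
        by blast
      finally show ?thesis .
    qed
    then show "Z \<in> down (unions XX (\<Union>F)) \<longleftrightarrow> Z \<in> \<Union> ((\<lambda>YY. down (unions XX YY)) ` F)"
      by (simp only: UN_iff mem_down_unions)
  qed
qed auto


section \<open>The language\<close>

datatype ('v, 'e) com =
    Skip
  | Assign 'v 'e
  | Seq "('v, 'e) com" "('v, 'e) com"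
  | If 'e "('v, 'e) com" "('v, 'e) com"
  | While 'e "('v, 'e) com"

type_synonym ('v, 'val) store = "'v \<Rightarrow> 'val"

primrec asgn :: "('v, 'e) com \<Rightarrow> 'v set" where
  "asgn Skip = {}"
| "asgn (Assign x E) = {x}"
| "asgn (Seq C\<^sub>1 C\<^sub>2) = asgn C\<^sub>1 \<union> asgn C\<^sub>2"
| "asgn (If E C\<^sub>1 C\<^sub>2) = asgn C\<^sub>1 \<union> asgn C\<^sub>2"
| "asgn (While E C) = asgn C"

text \<open>Expressions are abstract: \<open>ev E s\<close> is the value of \<open>E\<close> in the store \<open>s\<close>, and
  \<open>tst\<close> is the test that decides guards from their value.\<close>

inductive exec :: "('e \<Rightarrow> ('v, 'val) store \<Rightarrow> 'val) \<Rightarrow> ('val \<Rightarrow> bool) \<Rightarrow>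
    ('v, 'e) com \<Rightarrow> ('v, 'val) store \<Rightarrow> ('v, 'val) store \<Rightarrow> bool"
  for ev :: "'e \<Rightarrow> ('v, 'val) store \<Rightarrow> 'val" and tst :: "'val \<Rightarrow> bool" where
  Skip: "exec ev tst Skip s s"
| Assign: "exec ev tst (Assign x E) s (s(x := ev E s))"
| Seq: "\<lbrakk>exec ev tst C\<^sub>1 s s'; exec ev tst C\<^sub>2 s' s''\<rbrakk> \<Longrightarrow> exec ev tst (Seq C\<^sub>1 C\<^sub>2) s s''"
| IfTrue: "\<lbrakk>tst (ev E s); exec ev tst C\<^sub>1 s s'\<rbrakk> \<Longrightarrow> exec ev tst (If E C\<^sub>1 C\<^sub>2) s s'"
| IfFalse: "\<lbrakk>\<not> tst (ev E s); exec ev tst C\<^sub>2 s s'\<rbrakk> \<Longrightarrow> exec ev tst (If E C\<^sub>1 C\<^sub>2) s s'"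
| WhileFalse: "\<not> tst (ev E s) \<Longrightarrow> exec ev tst (While E C) s s"
| WhileTrue: "\<lbrakk>tst (ev E s); exec ev tst C s s'; exec ev tst (While E C) s' s''\<rbrakk>
    \<Longrightarrow> exec ev tst (While E C) s s''"

definition sem :: "('e \<Rightarrow> ('v, 'val) store \<Rightarrow> 'val) \<Rightarrow> ('val \<Rightarrow> bool) \<Rightarrow>
    ('v, 'e) com \<Rightarrow> ('v, 'val) store \<rightharpoonup> ('v, 'val) store" where
  "sem ev tst C s = (if \<exists>s'. exec ev tst C s s' then Some (THE s'. exec ev tst C s s') else None)"

inductive_cases exec_SkipE: "exec ev tst Skip s t"
inductive_cases exec_AssignE: "exec ev tst (Assign x E) s t"
inductive_cases exec_SeqE: "exec ev tst (Seq C\<^sub>1 C\<^sub>2) s t"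
inductive_cases exec_IfE: "exec ev tst (If E C\<^sub>1 C\<^sub>2) s t"
inductive_cases exec_WhileE: "exec ev tst (While E C) s t"

lemma exec_deterministic: "exec ev tst C s t \<Longrightarrow> exec ev tst C s u \<Longrightarrow> u = t"
proof (induction arbitrary: u rule: exec.induct)
  case (Skip s) then show ?case by (auto elim: exec_SkipE)
next
  case (Assign x E s) then show ?case by (auto elim: exec_AssignE)
next
  case (Seq C\<^sub>1 s s' C\<^sub>2 s'') then show ?case by (blast elim: exec_SeqE)
next
  case (IfTrue E s C\<^sub>1 s' C\<^sub>2) then show ?case by (blast elim: exec_IfE)
next
  case (IfFalse E s C\<^sub>2 s' C\<^sub>1) then show ?case by (blast elim: exec_IfE)
next
  case (WhileFalse E s C) then show ?case by (blast elim: exec_WhileE)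
next
  case (WhileTrue E s C s' s'')
  from WhileTrue.prems show ?case
    by (rule exec_WhileE) (use WhileTrue.hyps WhileTrue.IH in blast)+
qed

lemma sem_eq_Some_iff: "sem ev tst C s = Some t \<longleftrightarrow> exec ev tst C s t"
proof -
  have "(THE s'. exec ev tst C s s') = u" if "exec ev tst C s u" for u
    using that by (blast intro: the_equality exec_deterministic)
  then show ?thesis unfolding sem_def by (auto split: if_splits)
qed


section \<open>Mediators\<close>

text \<open>\<open>mediates h PP\<close> is \<open>h : PP \<Rightarrow> Id\<close>.\<close>

definition mediates :: "('d \<rightharpoonup> 'x) \<Rightarrow> 'd rel set \<Rightarrow> bool" where
  "mediates h PP \<longleftrightarrow>
    (\<exists>P \<in> PP. \<forall>d d'. (d, d') \<in> P \<and> h d \<noteq> None \<and> h d' \<noteq> None \<longrightarrow> h d = h d')"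

definition mediator_family :: "'d set \<Rightarrow> ('v \<Rightarrow> 'd \<rightharpoonup> 'val) \<Rightarrow> bool" where
  "mediator_family D g \<longleftrightarrow> (\<exists>A \<subseteq> D. \<forall>v. dom (g v) = A)"

definition hat :: "('v \<Rightarrow> 'd \<rightharpoonup> 'val) \<Rightarrow> 'd \<rightharpoonup> ('v, 'val) store" where
  "hat g d = (if \<forall>v. g v d \<noteq> None then Some (\<lambda>v. the (g v d)) else None)"

definition legal :: "('v \<Rightarrow> 'd \<rightharpoonup> 'val) \<Rightarrow> ('v \<Rightarrow> 'd rel set) \<Rightarrow> bool" where
  "legal g \<sigma> \<longleftrightarrow> (\<forall>v. mediates (g v) (\<sigma> v))"


section \<open>The algorithmic system\<close>

definition texp :: "('m, 'z) quantale_scheme \<Rightarrow> ('e \<Rightarrow> 'v set) \<Rightarrow> 'e \<Rightarrow> ('v \<Rightarrow> 'm) \<Rightarrow> 'm" where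
  "texp M fv E \<Gamma> = (\<Otimes>\<^bsub>M\<^esub>v\<in>fv E. \<Gamma> v)"

primrec alg :: "('m, 'z) quantale_scheme \<Rightarrow> ('e \<Rightarrow> 'v set) \<Rightarrow> ('v, 'e) com \<Rightarrow>
    'm \<Rightarrow> ('v \<Rightarrow> 'm) \<Rightarrow> ('v \<Rightarrow> 'm)" where
  "alg M fv Skip p \<Gamma> = \<Gamma>"
| "alg M fv (Assign x E) p \<Gamma> = \<Gamma>(x := p \<otimes>\<^bsub>M\<^esub> texp M fv E \<Gamma>)"
| "alg M fv (Seq C\<^sub>1 C\<^sub>2) p \<Gamma> = alg M fv C\<^sub>2 p (alg M fv C\<^sub>1 p \<Gamma>)"
| "alg M fv (If E C\<^sub>1 C\<^sub>2) p \<Gamma> =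
    (let t = texp M fv E \<Gamma>;
         \<Gamma>\<^sub>1 = alg M fv C\<^sub>1 (p \<otimes>\<^bsub>M\<^esub> t) \<Gamma>;
         \<Gamma>\<^sub>2 = alg M fv C\<^sub>2 (p \<otimes>\<^bsub>M\<^esub> t) \<Gamma>
     in (\<lambda>x. if x \<in> asgn C\<^sub>1 \<union> asgn C\<^sub>2 then t \<otimes>\<^bsub>M\<^esub> qjoin M (\<Gamma>\<^sub>1 x) (\<Gamma>\<^sub>2 x) else \<Gamma> x))"
| "alg M fv (While E C) p \<Gamma> =
    (let \<Gamma>s = env_lfp M (\<lambda>\<Theta> x. qjoin M (\<Gamma> x) (alg M fv C (p \<otimes>\<^bsub>M\<^esub> texp M fv E \<Theta>) \<Theta> x));
         t = texp M fv E \<Gamma>s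
     in (\<lambda>x. if x \<in> asgn C then qstar M t \<otimes>\<^bsub>M\<^esub> \<Gamma>s x else \<Gamma>s x))"

definition Delta :: "('e \<Rightarrow> 'v set) \<Rightarrow> ('v, 'e) com \<Rightarrow> 'v \<Rightarrow> 'v set set" where
  "Delta fv C = alg SetObj fv C \<one>\<^bsub>SetObj\<^esub> gen"

end

theory Submission
  imports Defs
begin

text \<open>
  Legality of \<open>g\<close> provides equivalence relations \<open>P v \<in> \<sigma> v\<close> on whose cells \<open>g v\<close> is constant. Call a
  labelling \<open>L\<close> of \<open>D\<close> by sets of variables coherent when it is constant on the cell of each point
  \<open>d\<close> under \<open>\<Inter>v\<in>L d. P v\<close>; these cells then form a partition mixed from the \<open>P\<close>s. By induction on
  the command, every variable \<open>w\<close> of the final store is constant on the cells of a coherent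
  labelling with values in \<open>\<Delta>\<^sub>C(w)\<close>. Pointwise unions of coherent labellings are coherent, so a set
  \<open>W\<close> of variables needs no separate induction, and at a conditional the guard's labelling selects
  which branch's labelling to add. As \<open>D\<close> is finite, a loop agrees with a finite unrolling of
  conditionals on all stores reached from \<open>D\<close>. The argument is carried out with sets of variables
  instead of in the quantale of information, because \<open>alpha\<close> is only laxly monoidal.
\<close>

section \<open>The algorithmic system over the set object\<close>

lemma above_one_SetObj: "XX \<in> above_one SetObj \<longleftrightarrow> down XX = XX \<and> {} \<in> XX"
  unfolding above_one_def SetObj_simps by (auto simp: down_def)

lemma mem_mult_SetObj: "Z \<in> XX \<otimes>\<^bsub>SetObj\<^esub> YY \<longleftrightarrow> (\<exists>X\<in>XX. \<exists>Y\<in>YY. Z \<subseteq> X \<union> Y)"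
  by (simp only: SetObj_simps mem_down_unions)

lemma mult_SetObj_mono:
  "XX \<subseteq> XX' \<Longrightarrow> YY \<subseteq> YY' \<Longrightarrow> XX \<otimes>\<^bsub>SetObj\<^esub> YY \<subseteq> XX' \<otimes>\<^bsub>SetObj\<^esub> YY'"
  unfolding subset_iff mem_mult_SetObj by meson

text \<open>Take \<open>{}\<close> from \<open>XX\<close> as the other summand. The lemma pads a
  label set by a factor above the unit: \<open>p\<close> at an assignment, the star in the base case
  of a loop.\<close>

lemma subset_mult_SetObj: "XX \<in> above_one SetObj \<Longrightarrow> YY \<subseteq> XX \<otimes>\<^bsub>SetObj\<^esub> YY"
  unfolding above_one_SetObj subset_iff mem_mult_SetObj by blast

lemma mult_above_one_SetObj:
  assumes "XX \<in> above_one SetObj" "YY \<in> above_one SetObj"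
  shows "XX \<otimes>\<^bsub>SetObj\<^esub> YY \<in> above_one SetObj"
proof -
  have "{} \<in> XX \<otimes>\<^bsub>SetObj\<^esub> YY"
    using assms unfolding mem_mult_SetObj above_one_SetObj by blast
  then show ?thesis by (simp add: above_one_SetObj SetObj_simps(2) down_idem)
qed

lemma one_above_one_SetObj: "\<one>\<^bsub>SetObj\<^esub> \<in> above_one SetObj"
  by (simp add: above_one_SetObj SetObj_simps(3) down_idem mem_down)

lemma join_above_one_SetObj:
  "XX \<in> above_one SetObj \<Longrightarrow> YY \<in> above_one SetObj \<Longrightarrow> XX \<union> YY \<in> above_one SetObj"
  unfolding above_one_SetObj by (auto simp: down_def)

lemma qjoin_SetObj: "qjoin SetObj XX YY = XX \<union> YY"
  by (simp add: qjoin_def SetObj_simps)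

lemma gen_envs: "gen \<in> envs SetObj"
  by (simp add: envs_def above_one_SetObj gen_def down_idem mem_down)

text \<open>Splitting off one factor at a time yields one choice per factor; packed into a function
  \<open>X\<close>, the choices no longer depend on an order of the factors. Inclusion replaces
  equality because the tensor is closed downwards.\<close>

lemma mem_finprod_SetObj:
  assumes "finite A" "\<And>v. v \<in> A \<Longrightarrow> \<Gamma> v \<in> carrier SetObj"
  shows "Z \<in> (\<Otimes>\<^bsub>SetObj\<^esub>v\<in>A. \<Gamma> v) \<longleftrightarrow> (\<exists>X. (\<forall>v\<in>A. X v \<in> \<Gamma> v) \<and> Z \<subseteq> (\<Union>v\<in>A. X v))"
  using assms
proof (induction A arbitrary: Z rule: finite_induct)
  interpret comm_quantale SetObj by (rule comm_quantale_SetObj)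
  case empty
  then show ?case by (simp add: SetObj_simps(3) mem_down)
next
  interpret comm_quantale SetObj by (rule comm_quantale_SetObj)
  case (insert a A)
  have "(\<Otimes>\<^bsub>SetObj\<^esub>v\<in>insert a A. \<Gamma> v) = \<Gamma> a \<otimes>\<^bsub>SetObj\<^esub> (\<Otimes>\<^bsub>SetObj\<^esub>v\<in>A. \<Gamma> v)"
    using insert by (intro finprod_insert) auto
  then have "Z \<in> (\<Otimes>\<^bsub>SetObj\<^esub>v\<in>insert a A. \<Gamma> v) \<longleftrightarrow>
      (\<exists>X0\<in>\<Gamma> a. \<exists>Y. (\<exists>X. (\<forall>v\<in>A. X v \<in> \<Gamma> v) \<and> Y \<subseteq> (\<Union>v\<in>A. X v)) \<and> Z \<subseteq> X0 \<union> Y)"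
    using insert by (simp add: mem_mult_SetObj Bex_def)
  also have "\<dots> \<longleftrightarrow> (\<exists>X. (\<forall>v\<in>insert a A. X v \<in> \<Gamma> v) \<and> Z \<subseteq> (\<Union>v\<in>insert a A. X v))"
  proof
    assume "\<exists>X0\<in>\<Gamma> a. \<exists>Y. (\<exists>X. (\<forall>v\<in>A. X v \<in> \<Gamma> v) \<and> Y \<subseteq> (\<Union>v\<in>A. X v)) \<and> Z \<subseteq> X0 \<union> Y"
    then obtain X0 Y X where *: "X0 \<in> \<Gamma> a" "\<forall>v\<in>A. X v \<in> \<Gamma> v" "Y \<subseteq> (\<Union>v\<in>A. X v)" "Z \<subseteq> X0 \<union> Y"
      by blast
    \<comment> \<open>As \<open>a\<close> is not in \<open>A\<close>, redefining \<open>X\<close> at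
      \<open>a\<close> does not touch the union over \<open>A\<close>.\<close>
    have union: "(\<Union>v\<in>insert a A. (X(a := X0)) v) = X0 \<union> (\<Union>v\<in>A. X v)"
      unfolding UNION_fun_upd using insert.hyps(2) by auto
    have mem: "\<forall>v\<in>insert a A. (X(a := X0)) v \<in> \<Gamma> v"
      using *(1,2) by simp
    have "Z \<subseteq> X0 \<union> (\<Union>v\<in>A. X v)" using *(3,4) by blast
    then show "\<exists>X. (\<forall>v\<in>insert a A. X v \<in> \<Gamma> v) \<and> Z \<subseteq> (\<Union>v\<in>insert a A. X v)"
      by (intro exI[of _ "X(a := X0)"] conjI mem) (simp only: union)
  next
    assume "\<exists>X. (\<forall>v\<in>insert a A. X v \<in> \<Gamma> v) \<and> Z \<subseteq> (\<Union>v\<in>insert a A. X v)"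
    then obtain X where *: "\<forall>v\<in>insert a A. X v \<in> \<Gamma> v" "Z \<subseteq> (\<Union>v\<in>insert a A. X v)" by blast
    show "\<exists>X0\<in>\<Gamma> a. \<exists>Y. (\<exists>X. (\<forall>v\<in>A. X v \<in> \<Gamma> v) \<and> Y \<subseteq> (\<Union>v\<in>A. X v)) \<and> Z \<subseteq> X0 \<union> Y"
      using * by (intro bexI[of _ "X a"] exI[of _ "\<Union>v\<in>A. X v"]) auto
  qed
  finally show ?case .
qed

section \<open>Guard terms, powers and the star in the set object\<close>

lemma mem_texp_SetObj:
  fixes \<Gamma> :: "'v::finite \<Rightarrow> 'w set set"
  assumes "\<Gamma> \<in> envs SetObj"
  shows "Z \<in> texp SetObj fv E \<Gamma> \<longleftrightarrow> (\<exists>X. (\<forall>v\<in>fv E. X v \<in> \<Gamma> v) \<and> Z \<subseteq> (\<Union>v\<in>fv E. X v))"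
  unfolding texp_def using assms
  by (intro mem_finprod_SetObj) (auto simp: envs_def above_one_def)

lemma texp_SetObj_mono:
  fixes \<Gamma> \<Theta> :: "'v::finite \<Rightarrow> 'w set set"
  assumes "\<Gamma> \<in> envs SetObj" "\<Theta> \<in> envs SetObj" "\<Gamma> \<le> \<Theta>"
  shows "texp SetObj fv E \<Gamma> \<subseteq> texp SetObj fv E \<Theta>"
proof
  fix Z assume "Z \<in> texp SetObj fv E \<Gamma>"
  then show "Z \<in> texp SetObj fv E \<Theta>"
    unfolding mem_texp_SetObj[OF assms(1)] mem_texp_SetObj[OF assms(2)]
    using assms(3) by (meson le_funD subsetD)
qed

lemma texp_above_one_SetObj:
  fixes \<Gamma> :: "'v::finite \<Rightarrow> 'w set set"
  assumes "\<Gamma> \<in> envs SetObj"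
  shows "texp SetObj fv E \<Gamma> \<in> above_one SetObj"
proof -
  have "{} \<in> texp SetObj fv E \<Gamma>"
    unfolding mem_texp_SetObj[OF assms]
    using assms by (intro exI[of _ "\<lambda>_. {}"]) (auto simp: envs_def above_one_SetObj)
  moreover have "down (texp SetObj fv E \<Gamma>) = texp SetObj fv E \<Gamma>"
  proof (rule subset_antisym[OF subsetI down_extensive])
    fix Z assume "Z \<in> down (texp SetObj fv E \<Gamma>)"
    then show "Z \<in> texp SetObj fv E \<Gamma>"
      by (simp only: mem_down Bex_def mem_texp_SetObj[OF assms]) (meson order_trans)
  qed
  ultimately show ?thesis by (simp add: above_one_SetObj)
qed

lemma pow_above_one_SetObj:
  "XX \<in> above_one SetObj \<Longrightarrow> XX [^]\<^bsub>SetObj\<^esub> (n::nat) \<in> above_one SetObj"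
proof (induction n)
  interpret comm_quantale SetObj by (rule comm_quantale_SetObj)
  case 0 then show ?case by (simp add: one_above_one_SetObj)
next
  interpret comm_quantale SetObj by (rule comm_quantale_SetObj)
  case (Suc n) then show ?case by (simp add: mult_above_one_SetObj)
qed

lemma pow_SetObj_mono: "XX \<subseteq> YY \<Longrightarrow> XX [^]\<^bsub>SetObj\<^esub> (n::nat) \<subseteq> YY [^]\<^bsub>SetObj\<^esub> n"
proof (induction n)
  interpret comm_quantale SetObj by (rule comm_quantale_SetObj)
  case 0 then show ?case by simp
next
  interpret comm_quantale SetObj by (rule comm_quantale_SetObj)
  case (Suc n) then show ?case by (simp add: mult_SetObj_mono)
qed

lemma qstar_SetObj: "qstar SetObj XX = (\<Union>n::nat. XX [^]\<^bsub>SetObj\<^esub> n)"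
  by (simp add: qstar_def SetObj_simps)

lemma qstar_SetObj_mono: "XX \<subseteq> YY \<Longrightarrow> qstar SetObj XX \<subseteq> qstar SetObj YY"
  unfolding qstar_SetObj by (intro UN_mono pow_SetObj_mono) auto

lemma qstar_above_one_SetObj:
  assumes "XX \<in> above_one SetObj"
  shows "qstar SetObj XX \<in> above_one SetObj"
proof -
  have "down (XX [^]\<^bsub>SetObj\<^esub> n) = XX [^]\<^bsub>SetObj\<^esub> n" "{} \<in> XX [^]\<^bsub>SetObj\<^esub> n" for n :: nat
    using pow_above_one_SetObj[OF assms, of n] by (auto simp: above_one_SetObj)
  then show ?thesis
    unfolding above_one_SetObj qstar_SetObj by (auto simp: down_def)
qed

text \<open>One loop round tests the guard and then either continues or exits. Its guard label
  raises a power by one and so disappears into the star; the exit case enters the star through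
  \<open>{}\<close>.\<close>

lemma qstar_SetObj_unfold:
  assumes XX: "XX \<in> above_one SetObj"
  shows "XX \<otimes>\<^bsub>SetObj\<^esub> ((qstar SetObj XX \<otimes>\<^bsub>SetObj\<^esub> YY) \<union> YY) \<subseteq> qstar SetObj XX \<otimes>\<^bsub>SetObj\<^esub> YY"
proof
  interpret comm_quantale SetObj by (rule comm_quantale_SetObj)
  fix Z assume "Z \<in> XX \<otimes>\<^bsub>SetObj\<^esub> ((qstar SetObj XX \<otimes>\<^bsub>SetObj\<^esub> YY) \<union> YY)"
  then obtain X Y where X: "X \<in> XX" and Y: "Y \<in> (qstar SetObj XX \<otimes>\<^bsub>SetObj\<^esub> YY) \<union> YY"
    and Z: "Z \<subseteq> X \<union> Y"
    unfolding mem_mult_SetObj by blast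
  have "{} \<in> qstar SetObj XX"
    using qstar_above_one_SetObj[OF XX] by (simp add: above_one_SetObj)
  \<comment> \<open>When \<open>Y\<close> comes from the bare \<open>YY\<close>, \<open>S\<close> is
    \<open>{}\<close> and \<open>V\<close> is \<open>Y\<close>.\<close>
  then obtain S V where S: "S \<in> qstar SetObj XX" "V \<in> YY" "Y \<subseteq> S \<union> V"
    using Y unfolding Un_iff mem_mult_SetObj by blast
  then obtain n :: nat where "S \<in> XX [^]\<^bsub>SetObj\<^esub> n" unfolding qstar_SetObj by blast
  then have "S \<union> X \<in> XX [^]\<^bsub>SetObj\<^esub> Suc n"
    unfolding nat_pow_Suc mem_mult_SetObj using X by blast
  then have "S \<union> X \<in> qstar SetObj XX" unfolding qstar_SetObj by blast
  then show "Z \<in> qstar SetObj XX \<otimes>\<^bsub>SetObj\<^esub> YY"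
    unfolding mem_mult_SetObj using S(2,3) Z by blast
qed

section \<open>Least fixed points and monotonicity of the system\<close>

text \<open>Knaster-Tarski within the environments above the unit. The last conclusion gives
  leastness among prefixed points, not only among fixed points as in \<open>env_lfp\<close>; this is
  what allows fixed points of two different maps to be compared.\<close>

lemma env_lfp_SetObj:
  assumes closed: "\<And>\<Theta>. \<Theta> \<in> envs SetObj \<Longrightarrow> F \<Theta> \<in> envs SetObj"
    and mono: "\<And>\<Theta> \<Theta>'. \<Theta> \<in> envs SetObj \<Longrightarrow> \<Theta>' \<in> envs SetObj \<Longrightarrow> \<Theta> \<le> \<Theta>' \<Longrightarrow> F \<Theta> \<le> F \<Theta>'"
  shows "env_lfp SetObj F \<in> envs SetObj" "F (env_lfp SetObj F) = env_lfp SetObj F"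
    and "\<And>\<Theta>. \<Theta> \<in> envs SetObj \<Longrightarrow> F \<Theta> \<le> \<Theta> \<Longrightarrow> env_lfp SetObj F \<le> \<Theta>"
proof -
  define L where "L = Inf {\<Theta> \<in> envs SetObj. F \<Theta> \<le> \<Theta>}"
  have le: "env_le SetObj = (\<le>)"
    by (intro ext) (simp add: env_le_def le_fun_def SetObj_simps)
  have lower: "L \<le> \<Theta>" if "\<Theta> \<in> envs SetObj" "F \<Theta> \<le> \<Theta>" for \<Theta>
    unfolding L_def using that by (intro Inf_lower) simp
  \<comment> \<open>Containing \<open>{}\<close> and being closed downwards both survive
    intersections, so the infimum is again an environment.\<close>
  have L: "L \<in> envs SetObj"
    unfolding envs_def mem_Collect_eq above_one_SetObj
  proof (intro allI conjI subset_antisym[OF _ down_extensive] subsetI)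
    have memL: "Z \<in> L v \<longleftrightarrow> (\<forall>\<Theta>\<in>envs SetObj. F \<Theta> \<le> \<Theta> \<longrightarrow> Z \<in> \<Theta> v)" for Z v
      unfolding L_def by auto
    show "{} \<in> L v" for v unfolding memL by (simp add: envs_def above_one_SetObj)
    fix Z v assume "Z \<in> down (L v)"
    then obtain Y where Y: "Y \<in> L v" "Z \<subseteq> Y" unfolding mem_down by blast
    show "Z \<in> L v" unfolding memL
    proof (intro ballI impI)
      fix \<Theta> assume \<Theta>: "\<Theta> \<in> envs SetObj" "F \<Theta> \<le> \<Theta>"
      then have "Y \<in> \<Theta> v" using Y(1) unfolding memL by blast
      then have "Z \<in> down (\<Theta> v)" unfolding mem_down using Y(2) by blast
      then show "Z \<in> \<Theta> v" using \<Theta>(1) by (simp add: envs_def above_one_SetObj)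
    qed
  qed
  have pre: "F L \<le> L"
    unfolding L_def
  proof (rule Inf_greatest)
    fix \<Theta> assume "\<Theta> \<in> {\<Theta> \<in> envs SetObj. F \<Theta> \<le> \<Theta>}"
    then have \<Theta>: "\<Theta> \<in> envs SetObj" "F \<Theta> \<le> \<Theta>" by auto
    have "F L \<le> F \<Theta>" using \<Theta> by (intro mono L lower)
    then show "F (Inf {\<Theta> \<in> envs SetObj. F \<Theta> \<le> \<Theta>}) \<le> \<Theta>" using \<Theta>(2) unfolding L_def by simp
  qed
  then have fp: "F L = L"
    using L by (intro order_antisym lower closed mono)
  have "env_lfp SetObj F = L"
    unfolding env_lfp_def le
    by (rule the_equality) (use L fp lower in \<open>auto intro: order_antisym\<close>)
  then show "env_lfp SetObj F \<in> envs SetObj" "F (env_lfp SetObj F) = env_lfp SetObj F"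
    and "\<And>\<Theta>. \<Theta> \<in> envs SetObj \<Longrightarrow> F \<Theta> \<le> \<Theta> \<Longrightarrow> env_lfp SetObj F \<le> \<Theta>"
    using L fp lower by auto
qed

text \<open>The map under the fixed point of the loop clause, with the join already written as a
  union; naming it lets closure and monotonicity be stated for it.\<close>

definition loop_step :: "('e \<Rightarrow> 'v set) \<Rightarrow> 'e \<Rightarrow> ('v, 'e) com \<Rightarrow> 'w set set \<Rightarrow>
    ('v \<Rightarrow> 'w set set) \<Rightarrow> ('v \<Rightarrow> 'w set set) \<Rightarrow> ('v \<Rightarrow> 'w set set)" where
  "loop_step fv E C p \<Gamma> \<Theta> =
     (\<lambda>x. \<Gamma> x \<union> alg SetObj fv C (p \<otimes>\<^bsub>SetObj\<^esub> texp SetObj fv E \<Theta>) \<Theta> x)"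

lemma alg_While_SetObj:
  "alg SetObj fv (While E C) p \<Gamma> =
    (let \<Gamma>s = env_lfp SetObj (loop_step fv E C p \<Gamma>)
     in (\<lambda>x. if x \<in> asgn C then qstar SetObj (texp SetObj fv E \<Gamma>s) \<otimes>\<^bsub>SetObj\<^esub> \<Gamma>s x else \<Gamma>s x))"
  by (simp add: loop_step_def[abs_def] qjoin_SetObj Let_def)

declare alg.simps(5) [simp del]

text \<open>Closure and monotonicity go through one induction: at a loop, even closure relies on the
  existence of the fixed point, hence on monotonicity of the body.\<close>

lemma alg_SetObj_envs_mono:
  fixes fv :: "'e \<Rightarrow> 'v::finite set" and p q :: "'w set set"
  shows "\<lbrakk>p \<in> above_one SetObj; \<Gamma> \<in> envs SetObj\<rbrakk> \<Longrightarrow> alg SetObj fv C p \<Gamma> \<in> envs SetObj"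
    and "\<lbrakk>p \<in> above_one SetObj; q \<in> above_one SetObj; \<Gamma> \<in> envs SetObj; \<Theta> \<in> envs SetObj;
          p \<subseteq> q; \<Gamma> \<le> \<Theta>\<rbrakk> \<Longrightarrow> alg SetObj fv C p \<Gamma> \<le> alg SetObj fv C q \<Theta>"
proof (induction C arbitrary: p q \<Gamma> \<Theta>)
  case Skip
  { case 1 then show ?case by simp }
  { case 2 then show ?case by simp }
next
  case (Assign x E)
  { case 1
    have "p \<otimes>\<^bsub>SetObj\<^esub> texp SetObj fv E \<Gamma> \<in> above_one SetObj"
      by (rule mult_above_one_SetObj[OF 1(1) texp_above_one_SetObj[OF 1(2)]])
    then show ?case using 1 by (simp add: envs_def) }
  { case 2
    then have "p \<otimes>\<^bsub>SetObj\<^esub> texp SetObj fv E \<Gamma> \<subseteq> q \<otimes>\<^bsub>SetObj\<^esub> texp SetObj fv E \<Theta>"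
      by (intro mult_SetObj_mono texp_SetObj_mono)
    then show ?case using 2 by (simp add: le_fun_def) }
next
  case (Seq C1 C2)
  { case 1 then show ?case using Seq.IH by simp }
  { case 2 then show ?case using Seq.IH by simp }
next
  case (If E C1 C2)
  let ?t = "texp SetObj fv E"
  { case 1
    have t: "?t \<Gamma> \<in> above_one SetObj" using 1 by (intro texp_above_one_SetObj)
    then have "p \<otimes>\<^bsub>SetObj\<^esub> ?t \<Gamma> \<in> above_one SetObj" using 1 by (intro mult_above_one_SetObj)
    then have "alg SetObj fv C1 (p \<otimes>\<^bsub>SetObj\<^esub> ?t \<Gamma>) \<Gamma> \<in> envs SetObj"
      "alg SetObj fv C2 (p \<otimes>\<^bsub>SetObj\<^esub> ?t \<Gamma>) \<Gamma> \<in> envs SetObj"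
      using 1 If.IH by auto
    then show ?case using 1 t
      by (auto simp: Let_def envs_def qjoin_SetObj
          intro!: mult_above_one_SetObj join_above_one_SetObj) }
  { case 2
    have t: "?t \<Gamma> \<in> above_one SetObj" "?t \<Theta> \<in> above_one SetObj" "?t \<Gamma> \<subseteq> ?t \<Theta>"
      using 2 by (auto intro!: texp_above_one_SetObj texp_SetObj_mono del: subsetI)
    let ?p = "p \<otimes>\<^bsub>SetObj\<^esub> ?t \<Gamma>" and ?q = "q \<otimes>\<^bsub>SetObj\<^esub> ?t \<Theta>"
    have "?p \<in> above_one SetObj" "?q \<in> above_one SetObj" "?p \<subseteq> ?q"
      using 2 t by (auto intro!: mult_above_one_SetObj mult_SetObj_mono del: subsetI)
    then have "alg SetObj fv C1 ?p \<Gamma> \<le> alg SetObj fv C1 ?q \<Theta>"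
      "alg SetObj fv C2 ?p \<Gamma> \<le> alg SetObj fv C2 ?q \<Theta>"
      using 2 If.IH(2,4) by auto
    then have "alg SetObj fv C1 ?p \<Gamma> x \<union> alg SetObj fv C2 ?p \<Gamma> x \<subseteq>
        alg SetObj fv C1 ?q \<Theta> x \<union> alg SetObj fv C2 ?q \<Theta> x" for x
      by (intro Un_mono) (auto dest: le_funD)
    then have "?t \<Gamma> \<otimes>\<^bsub>SetObj\<^esub> (alg SetObj fv C1 ?p \<Gamma> x \<union> alg SetObj fv C2 ?p \<Gamma> x) \<subseteq>
        ?t \<Theta> \<otimes>\<^bsub>SetObj\<^esub> (alg SetObj fv C1 ?q \<Theta> x \<union> alg SetObj fv C2 ?q \<Theta> x)" for x
      by (intro mult_SetObj_mono t)
    moreover have "\<Gamma> x \<subseteq> \<Theta> x" for x using 2 by (auto dest: le_funD)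
    ultimately show ?case by (simp add: Let_def qjoin_SetObj le_fun_def) }
next
  case (While E C)
  let ?t = "texp SetObj fv E"
  have closed: "loop_step fv E C p \<Gamma> \<Theta> \<in> envs SetObj"
    if "p \<in> above_one SetObj" "\<Gamma> \<in> envs SetObj" "\<Theta> \<in> envs SetObj"
    for p :: "'w set set" and \<Gamma> \<Theta>
  proof -
    have "alg SetObj fv C (p \<otimes>\<^bsub>SetObj\<^esub> ?t \<Theta>) \<Theta> \<in> envs SetObj"
      using that by (intro While.IH(1) mult_above_one_SetObj texp_above_one_SetObj)
    then show ?thesis
      using that by (simp add: loop_step_def envs_def join_above_one_SetObj)
  qed
  \<comment> \<open>Monotone in \<open>p\<close> and \<Gamma> as well as in the iterated
    environment, since the loops to be compared differ in those parameters.\<close>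
  have mono: "loop_step fv E C p \<Gamma> \<Theta> \<le> loop_step fv E C q \<Gamma>' \<Theta>'"
    if "p \<in> above_one SetObj" "q \<in> above_one SetObj" "p \<subseteq> q" "\<Gamma> \<le> \<Gamma>'"
      "\<Theta> \<in> envs SetObj" "\<Theta>' \<in> envs SetObj" "\<Theta> \<le> \<Theta>'"
    for p q :: "'w set set" and \<Gamma> \<Gamma>' \<Theta> \<Theta>'
  proof -
    have "alg SetObj fv C (p \<otimes>\<^bsub>SetObj\<^esub> ?t \<Theta>) \<Theta> \<le> alg SetObj fv C (q \<otimes>\<^bsub>SetObj\<^esub> ?t \<Theta>') \<Theta>'"
      using that by (intro While.IH(2) mult_above_one_SetObj texp_above_one_SetObj
          mult_SetObj_mono texp_SetObj_mono)
    with that(4) show ?thesis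
      unfolding loop_step_def le_fun_def by (intro allI Un_mono) auto
  qed
  have lfp: "env_lfp SetObj (loop_step fv E C p \<Gamma>) \<in> envs SetObj"
    "loop_step fv E C p \<Gamma> (env_lfp SetObj (loop_step fv E C p \<Gamma>))
      = env_lfp SetObj (loop_step fv E C p \<Gamma>)"
    "\<Theta> \<in> envs SetObj \<Longrightarrow> loop_step fv E C p \<Gamma> \<Theta> \<le> \<Theta> \<Longrightarrow>
      env_lfp SetObj (loop_step fv E C p \<Gamma>) \<le> \<Theta>"
    if "p \<in> above_one SetObj" "\<Gamma> \<in> envs SetObj" for p :: "'w set set" and \<Gamma> \<Theta>
    using env_lfp_SetObj[of "loop_step fv E C p \<Gamma>"] closed[OF that] mono[OF that(1,1)] by auto
  { case 1
    let ?G = "env_lfp SetObj (loop_step fv E C p \<Gamma>)"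
    have G: "?G \<in> envs SetObj" using 1 by (rule lfp(1))
    then have "qstar SetObj (?t ?G) \<in> above_one SetObj"
      by (intro qstar_above_one_SetObj texp_above_one_SetObj)
    then show ?case using G
      by (auto simp: alg_While_SetObj Let_def envs_def intro: mult_above_one_SetObj) }
  { case 2
    let ?G = "env_lfp SetObj (loop_step fv E C p \<Gamma>)"
    let ?H = "env_lfp SetObj (loop_step fv E C q \<Theta>)"
    have G: "?G \<in> envs SetObj" and H: "?H \<in> envs SetObj" using 2 by (auto intro: lfp(1))
    \<comment> \<open>The fixed point of the larger map is prefixed for the smaller one, so
      leastness puts \<open>?G\<close> below \<open>?H\<close>.\<close>
    have "loop_step fv E C p \<Gamma> ?H \<le> loop_step fv E C q \<Theta> ?H"
      using 2 H by (intro mono) auto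
    also have "\<dots> = ?H" using 2 by (intro lfp(2))
    finally have le: "?G \<le> ?H" using 2 H by (intro lfp(3))
    have "qstar SetObj (?t ?G) \<subseteq> qstar SetObj (?t ?H)"
      by (intro qstar_SetObj_mono texp_SetObj_mono G H le)
    then have "qstar SetObj (?t ?G) \<otimes>\<^bsub>SetObj\<^esub> ?G x \<subseteq> qstar SetObj (?t ?H) \<otimes>\<^bsub>SetObj\<^esub> ?H x" for x
      using le by (intro mult_SetObj_mono) (auto dest: le_funD)
    then show ?case using le
      by (simp add: alg_While_SetObj Let_def le_fun_def) }
qed

lemmas alg_SetObj_envs = alg_SetObj_envs_mono(1)

text \<open>The fixed point is a union of the entry environment and the body's result, hence above
  both. It thereby acts as an invariant at the loop head.\<close>

lemma loop_env_SetObj: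
  fixes fv :: "'e \<Rightarrow> 'v::finite set" and E :: 'e and C :: "('v, 'e) com"
  assumes p: "p \<in> above_one SetObj" and \<Gamma>: "\<Gamma> \<in> envs SetObj"
  defines "G \<equiv> env_lfp SetObj (loop_step fv E C p \<Gamma>)"
  shows "G \<in> envs SetObj" "\<Gamma> \<le> G"
    "alg SetObj fv C (p \<otimes>\<^bsub>SetObj\<^esub> texp SetObj fv E G) G \<le> G"
proof -
  have closed: "loop_step fv E C p \<Gamma> \<Theta> \<in> envs SetObj" if "\<Theta> \<in> envs SetObj" for \<Theta>
  proof -
    have "alg SetObj fv C (p \<otimes>\<^bsub>SetObj\<^esub> texp SetObj fv E \<Theta>) \<Theta> \<in> envs SetObj"
      using that p by (intro alg_SetObj_envs mult_above_one_SetObj texp_above_one_SetObj)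
    then show ?thesis using \<Gamma> by (simp add: loop_step_def envs_def join_above_one_SetObj)
  qed
  have mono: "loop_step fv E C p \<Gamma> \<Theta> \<le> loop_step fv E C p \<Gamma> \<Theta>'"
    if "\<Theta> \<in> envs SetObj" "\<Theta>' \<in> envs SetObj" "\<Theta> \<le> \<Theta>'" for \<Theta> \<Theta>'
  proof -
    have "alg SetObj fv C (p \<otimes>\<^bsub>SetObj\<^esub> texp SetObj fv E \<Theta>) \<Theta>
        \<le> alg SetObj fv C (p \<otimes>\<^bsub>SetObj\<^esub> texp SetObj fv E \<Theta>') \<Theta>'"
      using that p by (intro alg_SetObj_envs_mono(2) mult_above_one_SetObj texp_above_one_SetObj
          mult_SetObj_mono texp_SetObj_mono order_refl)
    then show ?thesis
      unfolding loop_step_def le_fun_def by (intro allI Un_mono) auto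
  qed
  show "G \<in> envs SetObj" unfolding G_def by (intro env_lfp_SetObj(1) closed mono)
  have "loop_step fv E C p \<Gamma> G = G" unfolding G_def by (intro env_lfp_SetObj(2) closed mono)
  then have "G x = \<Gamma> x \<union> alg SetObj fv C (p \<otimes>\<^bsub>SetObj\<^esub> texp SetObj fv E G) G x" for x
    unfolding loop_step_def by metis
  then show "\<Gamma> \<le> G" "alg SetObj fv C (p \<otimes>\<^bsub>SetObj\<^esub> texp SetObj fv E G) G \<le> G"
    by (auto simp: le_fun_def)
qed


section \<open>Unrolling loops\<close>

text \<open>Conditionals and loops add the guard's factor only to assigned variables; this fact
  justifies leaving the others alone.\<close>

lemma exec_unassigned: "exec ev tst C s t \<Longrightarrow> x \<notin> asgn C \<Longrightarrow> t x = s x"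
  by (induction rule: exec.induct) auto

lemma sem_unassigned: "sem ev tst C s = Some t \<Longrightarrow> x \<notin> asgn C \<Longrightarrow> t x = s x"
  by (auto simp: sem_eq_Some_iff dest: exec_unassigned)

text \<open>Kleene approximants of the loop: stores needing \<open>n\<close> or more rounds are
  undefined at stage \<open>n\<close>. They are partial maps and not commands, since with abstract
  guards a diverging command need not exist.\<close>

primrec unroll :: "('e \<Rightarrow> ('v, 'val) store \<Rightarrow> 'val) \<Rightarrow> ('val \<Rightarrow> bool) \<Rightarrow> 'e \<Rightarrow> ('v, 'e) com \<Rightarrow>
    nat \<Rightarrow> ('v, 'val) store \<rightharpoonup> ('v, 'val) store" where
  "unroll ev tst E C 0 = Map.empty"
| "unroll ev tst E C (Suc n) =
     (\<lambda>s. if tst (ev E s) then (unroll ev tst E C n \<circ>\<^sub>m sem ev tst C) s else Some s)"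

lemma unroll_sound: "unroll ev tst E C n s = Some t \<Longrightarrow> exec ev tst (While E C) s t"
  by (induction n arbitrary: s)
    (auto simp: map_comp_Some_iff sem_eq_Some_iff split: if_splits intro: exec.intros)

text \<open>Stated for all large \<open>m\<close>, so that the bounds of several stores can be
  replaced by a common one. The bound starts at 1 because stage 0 is undefined.\<close>

lemma unroll_complete:
  "exec ev tst (While E C) s t \<Longrightarrow> \<exists>n. \<forall>m\<ge>n. unroll ev tst E C m s = Some t"
proof (induction "While E C" s t rule: exec.induct)
  case (WhileFalse s)
  have "unroll ev tst E C m s = Some s" if "m \<ge> 1" for m
    using WhileFalse that by (cases m) auto
  then show ?case by blast
next
  case (WhileTrue s s' s'')
  then obtain n where n: "\<forall>m\<ge>n. unroll ev tst E C m s' = Some s''" by blast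
  have "sem ev tst C s = Some s'" using WhileTrue by (simp add: sem_eq_Some_iff)
  then have "unroll ev tst E C m s = Some s''" if "m \<ge> Suc n" for m
    using n that WhileTrue by (cases m) auto
  then show ?case by blast
qed

text \<open>At each store the approximants are eventually equal to the semantics: by completeness
  where the loop terminates, by soundness where it diverges. A finite set of stores admits a maximal
  bound.\<close>

lemma unroll_eq_sem:
  assumes "finite S"
  shows "\<exists>n. \<forall>s\<in>S. unroll ev tst E C n s = sem ev tst (While E C) s"
proof -
  have "\<exists>n. \<forall>m\<ge>n. unroll ev tst E C m s = sem ev tst (While E C) s" for s
  proof (cases "sem ev tst (While E C) s")
    case None
    have "unroll ev tst E C m s = None" for m
    proof (cases "unroll ev tst E C m s")
      case (Some t)
      then have "sem ev tst (While E C) s = Some t" by (simp add: sem_eq_Some_iff unroll_sound)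
      with None show ?thesis by simp
    qed simp
    then show ?thesis using None by simp
  next
    case (Some t)
    then have "exec ev tst (While E C) s t" by (simp only: sem_eq_Some_iff)
    from unroll_complete[OF this] show ?thesis unfolding Some .
  qed
  then obtain N where N: "\<And>s m. m \<ge> N s \<Longrightarrow> unroll ev tst E C m s = sem ev tst (While E C) s"
    by metis
  have "N s \<le> Max (N ` S)" if "s \<in> S" for s using assms that by simp
  then show ?thesis using N by blast
qed

lemma sem_simps:
  "sem ev tst Skip s = Some s"
  "sem ev tst (Assign x E) s = Some (s(x := ev E s))"
  "sem ev tst (Seq C1 C2) s = (sem ev tst C2 \<circ>\<^sub>m sem ev tst C1) s"
  "sem ev tst (If E C1 C2) s = (if tst (ev E s) then sem ev tst C1 s else sem ev tst C2 s)"
proof -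
  show "sem ev tst Skip s = Some s" "sem ev tst (Assign x E) s = Some (s(x := ev E s))"
    by (auto simp: sem_eq_Some_iff intro: exec.intros)
  have "sem ev tst (Seq C1 C2) s = Some t \<longleftrightarrow> (sem ev tst C2 \<circ>\<^sub>m sem ev tst C1) s = Some t" for t
    by (auto simp: sem_eq_Some_iff map_comp_Some_iff intro: exec.intros elim: exec_SeqE)
  then show "sem ev tst (Seq C1 C2) s = (sem ev tst C2 \<circ>\<^sub>m sem ev tst C1) s"
    by (metis not_Some_eq)
  have "sem ev tst (If E C1 C2) s = Some t \<longleftrightarrow>
      (if tst (ev E s) then sem ev tst C1 s else sem ev tst C2 s) = Some t" for t
    by (auto simp: sem_eq_Some_iff intro: exec.intros elim: exec_IfE)
  then show "sem ev tst (If E C1 C2) s = (if tst (ev E s) then sem ev tst C1 s else sem ev tst C2 s)"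
    by (metis not_Some_eq)
qed


section \<open>Coherent labellings\<close>

text \<open>The join of the \<open>P v\<close> in the lattice of information; intersecting with
  \<open>D \<times> D\<close> makes the empty join the total relation.\<close>

definition indist :: "'d set \<Rightarrow> ('v \<Rightarrow> 'd rel) \<Rightarrow> 'v set \<Rightarrow> 'd rel" where
  "indist D P X = {(d, d') \<in> D \<times> D. \<forall>v\<in>X. (d, d') \<in> P v}"

text \<open>\<open>L\<close> is a coherent labelling. Constancy of the label on its own cell makes
  the cells of different points equal or disjoint. As in \<open>mediates\<close>, values of
  \<open>h\<close> are compared only where both are defined.\<close>

definition resolves :: "'d set \<Rightarrow> ('v \<Rightarrow> 'd rel) \<Rightarrow> ('d \<rightharpoonup> 'x) \<Rightarrow> 'v set set \<Rightarrow> bool" where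
  "resolves D P h YY \<longleftrightarrow> (\<exists>L. (\<forall>d\<in>D. L d \<in> YY) \<and>
     (\<forall>d d'. (d, d') \<in> indist D P (L d) \<longrightarrow>
        L d' = L d \<and> (h d \<noteq> None \<longrightarrow> h d' \<noteq> None \<longrightarrow> h d = h d')))"

text \<open>The invariant of the induction on commands. Each variable has a labelling of its own,
  with no relation required between them.\<close>

definition describes :: "'d set \<Rightarrow> ('v \<Rightarrow> 'd rel) \<Rightarrow> ('d \<rightharpoonup> ('v, 'val) store) \<Rightarrow>
    ('v \<Rightarrow> 'v set set) \<Rightarrow> bool" where
  "describes D P f \<Gamma> \<longleftrightarrow> (\<forall>v. resolves D P (\<lambda>d. map_option (\<lambda>s. s v) (f d)) (\<Gamma> v))"

lemma indist_D: "(d, d') \<in> indist D P X \<Longrightarrow> d \<in> D \<and> d' \<in> D"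
  by (simp add: indist_def)

lemma indist_antimono: "(d, d') \<in> indist D P X \<Longrightarrow> Y \<subseteq> X \<Longrightarrow> (d, d') \<in> indist D P Y"
  by (auto simp: indist_def)

lemma indist_LoI:
  assumes "\<And>v. P v \<in> LoI D" shows "indist D P X \<in> LoI D"
  by (rule LoI_I)
    (auto simp: indist_def intro: LoI_refl[OF assms] LoI_sym[OF assms] LoI_trans[OF assms])

text \<open>The same labelling serves: it may take values in a larger set, and on \<open>D\<close>
  the map \<open>h'\<close> is a restriction of \<open>h\<close>, so fewer pairs are
  compared.\<close>

lemma resolves_mono:
  assumes "resolves D P h YY" "YY \<subseteq> YY'" "\<And>d. d \<in> D \<Longrightarrow> h' d \<noteq> None \<Longrightarrow> h' d = h d"
  shows "resolves D P h' YY'"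
proof -
  obtain L where L: "\<And>d. d \<in> D \<Longrightarrow> L d \<in> YY"
    "\<And>d d'. (d, d') \<in> indist D P (L d) \<Longrightarrow>
        L d' = L d \<and> (h d \<noteq> None \<longrightarrow> h d' \<noteq> None \<longrightarrow> h d = h d')"
    using assms(1) unfolding resolves_def by metis
  show ?thesis unfolding resolves_def
  proof (intro exI[of _ L] conjI ballI allI impI)
    show "L d \<in> YY'" if "d \<in> D" for d using L(1)[OF that] assms(2) by blast
    fix d d' assume dd': "(d, d') \<in> indist D P (L d)"
    then show "L d' = L d" using L(2) by blast
    assume "h' d \<noteq> None" "h' d' \<noteq> None"
    then show "h' d = h' d'" using L(2)[OF dd'] assms(3) indist_D[OF dd'] by metis
  qed
qed

lemma describes_mono: "describes D P f \<Gamma> \<Longrightarrow> \<Gamma> \<le> \<Theta> \<Longrightarrow> describes D P f \<Theta>"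
  unfolding describes_def by (metis resolves_mono le_funD)

text \<open>Label \<open>d\<close> by the union of its labels for the variables in \<open>A\<close>.
  The cell under the union lies inside each single cell, so all those labels are constant on it and
  all variables in \<open>A\<close> agree. Applied to expressions, guards and the final
  projection.\<close>

lemma describes_resolves:
  fixes \<Gamma> :: "'v::finite \<Rightarrow> 'v set set"
  assumes f: "describes D P f \<Gamma>" and \<Gamma>: "\<Gamma> \<in> envs SetObj"
    and k: "\<And>s s'. (\<forall>v\<in>A. s v = s' v) \<Longrightarrow> k s = k s'"
  shows "resolves D P (\<lambda>d. map_option k (f d)) (\<Otimes>\<^bsub>SetObj\<^esub>v\<in>A. \<Gamma> v)"
proof -
  obtain L where L: "\<And>v d. d \<in> D \<Longrightarrow> L v d \<in> \<Gamma> v"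
    "\<And>v d d'. (d, d') \<in> indist D P (L v d) \<Longrightarrow> L v d' = L v d \<and>
      (map_option (\<lambda>s. s v) (f d) \<noteq> None \<longrightarrow> map_option (\<lambda>s. s v) (f d') \<noteq> None \<longrightarrow>
        map_option (\<lambda>s. s v) (f d) = map_option (\<lambda>s. s v) (f d'))"
    using f unfolding describes_def resolves_def by metis
  show ?thesis unfolding resolves_def
  proof (intro exI[of _ "\<lambda>d. \<Union>v\<in>A. L v d"] conjI ballI allI impI)
    fix d assume "d \<in> D"
    then have "\<exists>X. (\<forall>v\<in>A. X v \<in> \<Gamma> v) \<and> (\<Union>v\<in>A. L v d) \<subseteq> (\<Union>v\<in>A. X v)"
      using L(1) by (intro exI[of _ "\<lambda>v. L v d"]) simp
    then show "(\<Union>v\<in>A. L v d) \<in> (\<Otimes>\<^bsub>SetObj\<^esub>v\<in>A. \<Gamma> v)"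
      using \<Gamma> by (subst mem_finprod_SetObj) (auto simp: envs_def above_one_def)
  next
    fix d d' assume "(d, d') \<in> indist D P (\<Union>v\<in>A. L v d)"
    then have *: "(d, d') \<in> indist D P (L v d)" if "v \<in> A" for v
      by (rule indist_antimono) (use that in blast)
    show "(\<Union>v\<in>A. L v d') = (\<Union>v\<in>A. L v d)"
      by (intro SUP_cong refl) (use * L(2) in blast)
    assume "map_option k (f d) \<noteq> None" "map_option k (f d') \<noteq> None"
    then obtain s s' where s: "f d = Some s" "f d' = Some s'" by auto
    have "s v = s' v" if "v \<in> A" for v using L(2)[OF *[OF that]] s by simp
    then show "map_option k (f d) = map_option k (f d')" using s k[of s s'] by simp
  qed
qed

text \<open>The new label is the guard's label together with that of the branch taken. Only one
  branch label is added at each point, which is why the bound has the union of the two label sets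
  and not their tensor.\<close>

lemma resolves_branch:
  assumes P: "\<And>v. P v \<in> LoI D"
    and b: "resolves D P b TT" and h1: "resolves D P h\<^sub>1 YY\<^sub>1" and h2: "resolves D P h\<^sub>2 YY\<^sub>2"
    and h: "\<And>d. d \<in> D \<Longrightarrow> h d \<noteq> None \<Longrightarrow>
      (b d = Some True \<and> h d = h\<^sub>1 d) \<or> (b d = Some False \<and> h d = h\<^sub>2 d)"
  shows "resolves D P h (TT \<otimes>\<^bsub>SetObj\<^esub> (YY\<^sub>1 \<union> YY\<^sub>2))"
proof -
  obtain T where T: "\<And>d. d \<in> D \<Longrightarrow> T d \<in> TT"
    "\<And>d d'. (d, d') \<in> indist D P (T d) \<Longrightarrow>
        T d' = T d \<and> (b d \<noteq> None \<longrightarrow> b d' \<noteq> None \<longrightarrow> b d = b d')"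
    using b unfolding resolves_def by metis
  obtain L1 where L1: "\<And>d. d \<in> D \<Longrightarrow> L1 d \<in> YY\<^sub>1"
    "\<And>d d'. (d, d') \<in> indist D P (L1 d) \<Longrightarrow>
        L1 d' = L1 d \<and> (h\<^sub>1 d \<noteq> None \<longrightarrow> h\<^sub>1 d' \<noteq> None \<longrightarrow> h\<^sub>1 d = h\<^sub>1 d')"
    using h1 unfolding resolves_def by metis
  obtain L2 where L2: "\<And>d. d \<in> D \<Longrightarrow> L2 d \<in> YY\<^sub>2"
    "\<And>d d'. (d, d') \<in> indist D P (L2 d) \<Longrightarrow>
        L2 d' = L2 d \<and> (h\<^sub>2 d \<noteq> None \<longrightarrow> h\<^sub>2 d' \<noteq> None \<longrightarrow> h\<^sub>2 d = h\<^sub>2 d')"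
    using h2 unfolding resolves_def by metis
  \<comment> \<open>The branch is read off the guard's cell, so that it is also determined at points where the
    guard is undefined.\<close>
  define B where "B d \<longleftrightarrow> (\<exists>e. (d, e) \<in> indist D P (T d) \<and> b e = Some True)" for d
  have B_cell: "B d' = B d" if dd': "(d, d') \<in> indist D P (T d)" for d d'
  proof -
    have "indist D P (T d) `` {d} = indist D P (T d) `` {d'}"
      using indist_LoI[OF P] dd' by (rule LoI_cell)
    then have "(d, e) \<in> indist D P (T d) \<longleftrightarrow> (d', e) \<in> indist D P (T d)" for e by blast
    moreover have T': "T d' = T d" using T(2)[OF dd'] by (rule conjunct1)
    ultimately show ?thesis unfolding B_def T' by blast
  qed
  \<comment> \<open>The point \<open>d\<close> lies in its own cell, and every other defined guard
    value there equals the one at \<open>d\<close>.\<close>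
  have B: "b d = Some (B d)" if d: "d \<in> D" "b d \<noteq> None" for d
  proof -
    have "(d, d) \<in> indist D P (T d)" using LoI_refl[OF indist_LoI[OF P] d(1)] .
    moreover obtain x where x: "b d = Some x" using d(2) by blast
    moreover have "b d = b e" if "(d, e) \<in> indist D P (T d)" "b e = Some True" for e
      using T(2)[OF that(1)] that(2) x by simp
    ultimately have "B d \<longleftrightarrow> x" unfolding B_def by (cases x) auto
    then show ?thesis using x by simp
  qed
  define L where "L d = T d \<union> (if B d then L1 d else L2 d)" for d
  show ?thesis unfolding resolves_def
  proof (intro exI[of _ L] conjI ballI allI impI)
    fix d assume "d \<in> D"
    then have "T d \<in> TT" "(if B d then L1 d else L2 d) \<in> YY\<^sub>1 \<union> YY\<^sub>2"
      using T(1) L1(1) L2(1) by auto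
    then show "L d \<in> TT \<otimes>\<^bsub>SetObj\<^esub> (YY\<^sub>1 \<union> YY\<^sub>2)"
      unfolding mem_mult_SetObj L_def by blast
  next
    fix d d' assume *: "(d, d') \<in> indist D P (L d)"
    have t: "(d, d') \<in> indist D P (T d)"
      using * by (rule indist_antimono) (simp add: L_def)
    have l: "(d, d') \<in> indist D P (if B d then L1 d else L2 d)"
      using * by (rule indist_antimono) (simp add: L_def)
    have D: "d \<in> D" "d' \<in> D" using indist_D[OF *] by auto
    have T': "T d' = T d" and B': "B d' = B d" using T(2)[OF t] B_cell[OF t] by auto
    \<comment> \<open>Both points have the same guard label and choose the same branch, so coherence
      of that branch's labelling is enough.\<close>
    show "L d' = L d"
      using l L1(2) L2(2) unfolding L_def T' B' by (auto split: if_splits)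
    assume hd: "h d \<noteq> None" "h d' \<noteq> None"
    note hD = h[OF D(1) hd(1)] h[OF D(2) hd(2)]
    then have "b d \<noteq> None" "b d' \<noteq> None" by auto
    then have bB: "b d = Some (B d)" "b d' = Some (B d)" using B[OF D(1)] B[OF D(2)] B' by simp_all
    show "h d = h d'"
    proof (cases "B d")
      case True
      then have "h d = h\<^sub>1 d" "h d' = h\<^sub>1 d'" using hD bB by auto
      then show ?thesis using L1(2)[of d d'] l True hd by simp
    next
      case False
      then have "h d = h\<^sub>2 d" "h d' = h\<^sub>2 d'" using hD bB by auto
      then show ?thesis using L2(2)[of d d'] l False hd by simp
    qed
  qed
qed

section \<open>Soundness of the algorithmic system for labellings\<close>

lemma describes_sem:
  fixes D :: "'d set" and fv :: "'e \<Rightarrow> 'v::finite set"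
    and ev :: "'e \<Rightarrow> ('v, 'val) store \<Rightarrow> 'val"
  assumes D: "finite D" and P: "\<And>v. P v \<in> LoI D"
    and ev: "\<And>E s s'. (\<forall>v \<in> fv E. s v = s' v) \<Longrightarrow> ev E s = ev E s'"
  shows "\<lbrakk>describes D P f \<Gamma>; \<Gamma> \<in> envs SetObj; p \<in> above_one SetObj\<rbrakk> \<Longrightarrow>
    describes D P (sem ev tst C \<circ>\<^sub>m f) (alg SetObj fv C p \<Gamma>)"
\<comment> \<open>The map \<open>f\<close> varies because sequences and loops run a command after
  \<open>f\<close> has been composed with an earlier one.\<close>
proof (induction C arbitrary: f \<Gamma> p)
  case Skip
  have "sem ev tst Skip \<circ>\<^sub>m f = f"
    by (rule ext) (simp add: map_comp_def sem_simps split: option.splits)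
  then show ?case using Skip by simp
next
  case (Assign x E)
  show ?case unfolding describes_def
  proof
    fix v
    show "resolves D P (\<lambda>d. map_option (\<lambda>s. s v) ((sem ev tst (Assign x E) \<circ>\<^sub>m f) d))
      (alg SetObj fv (Assign x E) p \<Gamma> v)"
    proof (cases "v = x")
      case True
      have "resolves D P (\<lambda>d. map_option (ev E) (f d)) (texp SetObj fv E \<Gamma>)"
        unfolding texp_def using Assign ev by (intro describes_resolves)
      moreover have "texp SetObj fv E \<Gamma> \<subseteq> p \<otimes>\<^bsub>SetObj\<^esub> texp SetObj fv E \<Gamma>"
        using Assign(3) by (rule subset_mult_SetObj)
      ultimately have "resolves D P (\<lambda>d. map_option (ev E) (f d)) (p \<otimes>\<^bsub>SetObj\<^esub> texp SetObj fv E \<Gamma>)"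
        by (rule resolves_mono) simp
      then show ?thesis
        using True by (simp add: map_comp_def sem_simps map_option_case option.case_distrib
            cong: option.case_cong)
    next
      case False
      have "resolves D P (\<lambda>d. map_option (\<lambda>s. s v) (f d)) (\<Gamma> v)"
        using Assign(1) by (simp add: describes_def)
      then show ?thesis using False
        by (elim resolves_mono) (auto simp: map_comp_def sem_simps split: option.splits)
    qed
  qed
next
  case (Seq C1 C2)
  have "sem ev tst (Seq C1 C2) \<circ>\<^sub>m f = sem ev tst C2 \<circ>\<^sub>m (sem ev tst C1 \<circ>\<^sub>m f)"
    by (rule ext) (simp add: map_comp_def sem_simps split: option.splits)
  moreover have "alg SetObj fv C1 p \<Gamma> \<in> envs SetObj" using Seq.prems by (intro alg_SetObj_envs)
  ultimately show ?case using Seq by simp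
next
  case (If E C1 C2)
  let ?t = "texp SetObj fv E \<Gamma>"
  let ?p = "p \<otimes>\<^bsub>SetObj\<^esub> ?t"
  have p: "?p \<in> above_one SetObj"
    using If.prems by (intro mult_above_one_SetObj texp_above_one_SetObj)
  have b: "resolves D P (\<lambda>d. map_option (\<lambda>s. tst (ev E s)) (f d)) ?t"
    unfolding texp_def using If.prems ev by (intro describes_resolves) metis+
  have IH: "describes D P (sem ev tst C1 \<circ>\<^sub>m f) (alg SetObj fv C1 ?p \<Gamma>)"
    "describes D P (sem ev tst C2 \<circ>\<^sub>m f) (alg SetObj fv C2 ?p \<Gamma>)"
    using If p by auto
  show ?case unfolding describes_def
  proof
    fix v
    show "resolves D P (\<lambda>d. map_option (\<lambda>s. s v) ((sem ev tst (If E C1 C2) \<circ>\<^sub>m f) d))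
      (alg SetObj fv (If E C1 C2) p \<Gamma> v)"
    proof (cases "v \<in> asgn C1 \<union> asgn C2")
      case True
      have "resolves D P (\<lambda>d. map_option (\<lambda>s. s v) ((sem ev tst (If E C1 C2) \<circ>\<^sub>m f) d))
          (?t \<otimes>\<^bsub>SetObj\<^esub> (alg SetObj fv C1 ?p \<Gamma> v \<union> alg SetObj fv C2 ?p \<Gamma> v))"
        by (rule resolves_branch[OF P b IH[unfolded describes_def, rule_format]])
          (auto simp: map_comp_def sem_simps split: option.splits if_splits)
      then show ?thesis using True by (simp add: Let_def qjoin_SetObj)
    next
      case False
      then have unassigned: "v \<notin> asgn (If E C1 C2)" by simp
      have "resolves D P (\<lambda>d. map_option (\<lambda>s. s v) (f d)) (\<Gamma> v)"
        using If.prems(1) by (simp add: describes_def)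
      then show ?thesis using False
        by (elim resolves_mono)
          (auto simp: map_comp_def Let_def split: option.splits
            dest: sem_unassigned[OF _ unassigned])
    qed
  qed
next
  case (While E C)
  define G where "G = env_lfp SetObj (loop_step fv E C p \<Gamma>)"
  define t where "t = texp SetObj fv E G"
  have G: "G \<in> envs SetObj" "\<Gamma> \<le> G" "alg SetObj fv C (p \<otimes>\<^bsub>SetObj\<^esub> t) G \<le> G"
    unfolding G_def t_def using While.prems by (auto intro!: loop_env_SetObj)
  have t: "t \<in> above_one SetObj" unfolding t_def using G by (intro texp_above_one_SetObj)
  have pt: "p \<otimes>\<^bsub>SetObj\<^esub> t \<in> above_one SetObj" using While.prems t by (intro mult_above_one_SetObj)
  \<comment> \<open>The body carries maps described by \<open>G\<close> to maps described by
    \<open>G\<close>, and the bound is the same for every \<open>n\<close>. This uniformity permits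
    choosing \<open>n\<close> later.\<close>
  have unroll: "resolves D P (\<lambda>d. map_option (\<lambda>s. s v) ((unroll ev tst E C n \<circ>\<^sub>m f) d))
      (qstar SetObj t \<otimes>\<^bsub>SetObj\<^esub> G v)" if "describes D P f G" for v n f
    using that
  proof (induction n arbitrary: f)
    case 0
    \<comment> \<open>At stage 0 nothing is defined, so any coherent labelling will do; the one
      given for \<open>f\<close> is at hand.\<close>
    then have f: "resolves D P (\<lambda>d. map_option (\<lambda>s. s v) (f d)) (G v)" by (simp add: describes_def)
    have "G v \<subseteq> qstar SetObj t \<otimes>\<^bsub>SetObj\<^esub> G v"
      by (intro subset_mult_SetObj qstar_above_one_SetObj t)
    with f show ?case by (rule resolves_mono) (auto simp: map_comp_def split: option.splits)
  next
    case (Suc n)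
    have "resolves D P (\<lambda>d. map_option (\<lambda>s. tst (ev E s)) (f d)) t"
      unfolding t_def texp_def using Suc.prems G(1) ev by (intro describes_resolves) metis+
    moreover have "describes D P (sem ev tst C \<circ>\<^sub>m f) G"
      using While.IH[OF Suc.prems G(1) pt] G(3) by (rule describes_mono)
    then have "resolves D P
        (\<lambda>d. map_option (\<lambda>s. s v) ((unroll ev tst E C n \<circ>\<^sub>m (sem ev tst C \<circ>\<^sub>m f)) d))
        (qstar SetObj t \<otimes>\<^bsub>SetObj\<^esub> G v)"
      by (rule Suc.IH)
    moreover have "resolves D P (\<lambda>d. map_option (\<lambda>s. s v) (f d)) (G v)"
      using Suc.prems by (simp add: describes_def)
    \<comment> \<open>True guard: one body run, then \<open>n\<close>-stage unrolling; false guard: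
      the current store.\<close>
    ultimately have "resolves D P (\<lambda>d. map_option (\<lambda>s. s v) ((unroll ev tst E C (Suc n) \<circ>\<^sub>m f) d))
        (t \<otimes>\<^bsub>SetObj\<^esub> ((qstar SetObj t \<otimes>\<^bsub>SetObj\<^esub> G v) \<union> G v))"
      by (rule resolves_branch[OF P])
        (auto simp: map_comp_def split: option.splits if_splits)
    then show ?case by (rule resolves_mono[OF _ qstar_SetObj_unfold[OF t]]) simp
  qed
  have f: "describes D P f G" using While.prems(1) G(2) by (rule describes_mono)
  \<comment> \<open>Only the stores reached from \<open>D\<close> matter, so one approximant can
    stand for the loop.\<close>
  have "finite {s. \<exists>d\<in>D. f d = Some s}"
  proof (rule finite_subset)
    show "{s. \<exists>d\<in>D. f d = Some s} \<subseteq> (\<lambda>d. the (f d)) ` D" by force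
  qed (use D in simp)
  from unroll_eq_sem[OF this, of ev tst E C] obtain n where
    n: "\<And>s d. d \<in> D \<Longrightarrow> f d = Some s \<Longrightarrow> unroll ev tst E C n s = sem ev tst (While E C) s"
    by blast
  show ?case unfolding describes_def
  proof
    fix v
    show "resolves D P (\<lambda>d. map_option (\<lambda>s. s v) ((sem ev tst (While E C) \<circ>\<^sub>m f) d))
      (alg SetObj fv (While E C) p \<Gamma> v)"
    proof (cases "v \<in> asgn C")
      case True
      have "resolves D P (\<lambda>d. map_option (\<lambda>s. s v) ((sem ev tst (While E C) \<circ>\<^sub>m f) d))
          (qstar SetObj t \<otimes>\<^bsub>SetObj\<^esub> G v)"
        by (rule resolves_mono[OF unroll[OF f, where n = n] order_refl])
          (auto simp: map_comp_def n split: option.splits)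
      then show ?thesis using True by (simp add: alg_While_SetObj Let_def G_def t_def)
    next
      case False
      then have unassigned: "v \<notin> asgn (While E C)" by simp
      have "resolves D P (\<lambda>d. map_option (\<lambda>s. s v) (f d)) (G v)"
        using f by (simp add: describes_def)
      then show ?thesis using False
        by (elim resolves_mono)
          (auto simp: map_comp_def alg_While_SetObj Let_def G_def split: option.splits
            dest: sem_unassigned[OF _ unassigned])
    qed
  qed
qed

section \<open>From labellings to the quantale of information\<close>

lemma indist_mem_finprod:
  fixes \<sigma> :: "'v::finite \<Rightarrow> 'd rel set"
  assumes "\<And>v. \<sigma> v \<in> carrier (QoI D)" "\<And>v. P v \<in> \<sigma> v"
  shows "indist D P X \<in> (\<Otimes>\<^bsub>QoI D\<^esub>v\<in>X. \<sigma> v)"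
  using finite[of X]
proof (induction X rule: finite_induct)
  interpret comm_quantale "QoI D" by (rule comm_quantale_QoI)
  case empty
  show ?case by (simp add: indist_def QoI_simps)
next
  interpret comm_quantale "QoI D" by (rule comm_quantale_QoI)
  case (insert a X)
  let ?F = "\<Otimes>\<^bsub>QoI D\<^esub>v\<in>X. \<sigma> v"
  have F: "?F \<in> carrier (QoI D)" using assms(1) by (intro finprod_closed) auto
  \<comment> \<open>Intersecting relations is joining them in the lattice of information, and the
    tensor contains all such joins.\<close>
  have "P a \<inter> indist D P X \<in> meets (\<sigma> a) ?F"
    unfolding meets_def using assms(2) insert.IH by blast
  moreover have "meets (\<sigma> a) ?F \<subseteq> LoI D"
    using F assms(1)[of a] by (intro meets_LoI) (auto simp: QoI_simps)
  ultimately have "P a \<inter> indist D P X \<in> \<sigma> a \<otimes>\<^bsub>QoI D\<^esub> ?F"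
    unfolding QoI_simps using tc_extensive by blast
  moreover have "indist D P (insert a X) = P a \<inter> indist D P X"
    by (auto simp: indist_def)
  ultimately show ?case
    using insert.hyps assms(1) by (subst finprod_insert) auto
qed

text \<open>The cells of a coherent labelling are glued to one relation \<open>R\<close>. Each is a
  cell of a relation belonging to the tensor of some label in \<open>YY\<close>, so \<open>R\<close>
  is a mix of the union of these tensors and lies in their join.\<close>

lemma resolves_mediates:
  fixes \<sigma> :: "'v::finite \<Rightarrow> 'd rel set"
  assumes \<sigma>: "\<And>v. \<sigma> v \<in> carrier (QoI D)" "\<And>v. P v \<in> \<sigma> v"
    and h: "resolves D P h YY"
  shows "mediates h (alpha (QoI D) \<sigma> YY)"
proof -
  interpret comm_quantale "QoI D" by (rule comm_quantale_QoI)
  have P: "P v \<in> LoI D" for v using \<sigma>[of v] by (auto simp: QoI_simps)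
  have I: "indist D P X \<in> LoI D" for X using P by (rule indist_LoI)
  obtain L where L: "\<And>d. d \<in> D \<Longrightarrow> L d \<in> YY"
    "\<And>d d'. (d, d') \<in> indist D P (L d) \<Longrightarrow>
        L d' = L d \<and> (h d \<noteq> None \<longrightarrow> h d' \<noteq> None \<longrightarrow> h d = h d')"
    using h unfolding resolves_def by metis
  define R where "R = {(d, d'). (d, d') \<in> indist D P (L d)}"
  let ?U = "\<Union> ((\<lambda>X. \<Otimes>\<^bsub>QoI D\<^esub>v\<in>X. \<sigma> v) ` YY)"
  have "(\<Otimes>\<^bsub>QoI D\<^esub>v\<in>X. \<sigma> v) \<in> carrier (QoI D)" for X
    using \<sigma>(1) by (intro finprod_closed) auto
  then have U: "?U \<subseteq> LoI D" by (auto simp: QoI_simps)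
  have "R \<in> LoI D"
  proof (rule LoI_I)
    show "R \<subseteq> D \<times> D" by (auto simp: R_def indist_def)
    show "(a, a) \<in> R" if "a \<in> D" for a using LoI_refl[OF I that] by (simp add: R_def)
    \<comment> \<open>Related points carry equal labels, so symmetry, and likewise transitivity,
      reduces to a single \<open>indist\<close> relation.\<close>
    show "(b, a) \<in> R" if "(a, b) \<in> R" for a b
      using that L(2)[of a b] LoI_sym[OF I] by (simp add: R_def)
    show "(a, c) \<in> R" if "(a, b) \<in> R" "(b, c) \<in> R" for a b c
      using that L(2)[of a b] LoI_trans[OF I, of a b "L a" c] by (simp add: R_def)
  qed
  moreover have "\<exists>Q\<in>?U. R `` {a} = Q `` {a}" if "a \<in> D" for a
  proof (rule bexI)
    show "R `` {a} = indist D P (L a) `` {a}" by (auto simp: R_def)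
    show "indist D P (L a) \<in> ?U"
      using L(1)[OF that] indist_mem_finprod[of \<sigma> D P, OF \<sigma>] by blast
  qed
  ultimately have "R \<in> mix D ?U" by (simp only: mem_mix[OF U]) blast
  then have "R \<in> alpha (QoI D) \<sigma> YY"
    unfolding alpha_def QoI_simps tc_def using \<open>R \<in> LoI D\<close> by blast
  then show ?thesis
    unfolding mediates_def using L(2) by (intro bexI[of _ R]) (auto simp: R_def)
qed

theorem theorem4:
  fixes D :: "'d set"
    and \<sigma> :: "'v::finite \<Rightarrow> 'd rel set"
    and g :: "'v \<Rightarrow> 'd \<rightharpoonup> 'val"
    and fv :: "'e \<Rightarrow> 'v set"
    and ev :: "'e \<Rightarrow> ('v, 'val) store \<Rightarrow> 'val"
    and tst :: "'val \<Rightarrow> bool"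
    and C :: "('v, 'e) com"
    and W :: "'v set"
  assumes "finite D"
    and "\<And>E s s'. (\<forall>v \<in> fv E. s v = s' v) \<Longrightarrow> ev E s = ev E s'"
    and "\<forall>v. \<sigma> v \<in> above_one (QoI D)"
    and "mediator_family D g"
    and "legal g \<sigma>"
  shows "mediates ((\<lambda>s. Some (restrict s W)) \<circ>\<^sub>m sem ev tst C \<circ>\<^sub>m hat g)
           (alpha (QoI D) \<sigma> (\<Otimes>\<^bsub>SetObj\<^esub>w\<in>W. Delta fv C w))"
proof -
  obtain P where P: "\<And>v. P v \<in> \<sigma> v"
    "\<And>v d d'. \<lbrakk>(d, d') \<in> P v; g v d \<noteq> None; g v d' \<noteq> None\<rbrakk> \<Longrightarrow> g v d = g v d'"
    using assms(5) unfolding legal_def mediates_def by metis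
  have \<sigma>: "\<sigma> v \<in> carrier (QoI D)" for v using assms(3) by (simp add: above_one_def)
  then have L: "P v \<in> LoI D" for v using P(1)[of v] \<sigma>[of v] by (auto simp: QoI_simps)
  \<comment> \<open>Variable \<open>v\<close> gets the constant label \<open>{v}\<close>, whose
    cells are those of \<open>P v\<close>. Where \<open>hat g\<close> is defined all components are,
    so legality applies.\<close>
  have "describes D P (hat g) gen"
    unfolding describes_def resolves_def
  proof (intro allI exI[of _ "\<lambda>_. {_}"] conjI ballI impI refl)
    show "{v} \<in> gen v" for v :: 'v by (simp add: gen_def mem_down)
    fix v d d'
    assume *: "(d, d') \<in> indist D P {v}" "map_option (\<lambda>s. s v) (hat g d) \<noteq> None"
      "map_option (\<lambda>s. s v) (hat g d') \<noteq> None"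
    then have dom: "\<forall>v. g v d \<noteq> None" "\<forall>v. g v d' \<noteq> None"
      by (auto simp: hat_def split: if_splits)
    then have "g v d = g v d'"
      using *(1) by (intro P(2)) (simp_all add: indist_def)
    then show "map_option (\<lambda>s. s v) (hat g d) = map_option (\<lambda>s. s v) (hat g d')"
      using dom by (simp add: hat_def)
  qed
  then have "describes D P (sem ev tst C \<circ>\<^sub>m hat g) (Delta fv C)"
    unfolding Delta_def using assms(1,2) L
    by (intro describes_sem gen_envs one_above_one_SetObj)
  moreover have "Delta fv C \<in> envs SetObj"
    unfolding Delta_def by (intro alg_SetObj_envs gen_envs one_above_one_SetObj)
  \<comment> \<open>The projection depends only on the variables in \<open>W\<close>, so their
    labels combine into the tensor over \<open>W\<close>.\<close>
  ultimately have "resolves D P (\<lambda>d. map_option (\<lambda>s. restrict s W) ((sem ev tst C \<circ>\<^sub>m hat g) d))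
      (\<Otimes>\<^bsub>SetObj\<^esub>w\<in>W. Delta fv C w)"
    by (rule describes_resolves) (auto simp: restrict_def)
  then have "resolves D P ((\<lambda>s. Some (restrict s W)) \<circ>\<^sub>m sem ev tst C \<circ>\<^sub>m hat g)
      (\<Otimes>\<^bsub>SetObj\<^esub>w\<in>W. Delta fv C w)"
    by (rule resolves_mono) (auto simp: map_comp_def split: option.splits)
  then show ?thesis by (rule resolves_mediates[OF \<sigma> P(1)])
qed

end
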